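(* Let $k\in\mathbb{R}$, $\lambda\in\mathbb{C}$, and let $s\in\mathbb{C}$ satisfy $s(1-s)=\frac14+\lambda^2$, such that none of $s-|k|$, $s+|k|$, $2s$ is a non-positive integer. Define, for $w\in\mathbb{D}\setminus\{0\}$, with $y=\cosh^2(d(0,w)/2)=1/(1-|w|^2)$, $$G_k(s,w)=\frac{\Gamma(s-|k|)\Gamma(s+|k|)}{4\pi\Gamma(2s)}\,y^{-s}F\big(s-|k|,\,s+|k|,\,2s,\,y^{-1}\big).$$ Then $(-\mathcal{D}_k-\lambda^2)G_k=\delta$ in the sense of distributions on $\mathbb{D}$, where $\delta$ is the Dirac measure at $0$; that is, for every $\varphi\in C_c^\infty(\mathbb{D})$, $$\int_{\mathbb{D}}G_k(s,w)\,\big(-\mathcal{D}_{-k}-\lambda^2\big)\varphi(w)\,d\mu(w)=\varphi(0).$$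
   Context: $\mathbb{D}=\{w\in\mathbb{C}:|w|<1\}$ with hyperbolic metric $ds=2|dw|/(1-|w|^2)$, area measure $d\mu(w)=\frac{4\,du\,dv}{(1-|w|^2)^2}$ ($w=u+iv$), and hyperbolic distance $d$ with $\cosh^2(d(w,w')/2)=\frac{|1-w\overline{w'}|^2}{(1-|w|^2)(1-|w'|^2)}$. For $k\in\mathbb{R}$, $\mathcal{D}_k=(1-|w|^2)^2\frac{\partial^2}{\partial w\partial\bar w}+k(1-|w|^2)w\frac{\partial}{\partial w}-k(1-|w|^2)\bar w\frac{\partial}{\partial\bar w}-k^2|w|^2+k^2+\frac14$; its formal transpose with respect to $d\mu$ is $\mathcal{D}_{-k}$, which defines $\mathcal{D}_k$ on distributions. $F(a,b,c,z)=\sum_{n\ge0}\frac{(a)_n(b)_n}{(c)_n n!}z^n$ is the Gauss hypergeometric function ($(a)_n=\Gamma(a+n)/\Gamma(a)$); $y^{-s}$ is the principal power. *)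

theory Defs
  imports "HOL-Analysis.Analysis"
begin

definition hyp2F1 :: "complex \<Rightarrow> complex \<Rightarrow> complex \<Rightarrow> complex \<Rightarrow> complex" where
  "hyp2F1 a b c z = (\<Sum>n. pochhammer a n * pochhammer b n / (pochhammer c n * fact n) * z ^ n)"

definition pd :: "complex \<Rightarrow> (complex \<Rightarrow> complex) \<Rightarrow> complex \<Rightarrow> complex" where
  "pd d f z = vector_derivative (\<lambda>t::real. f (z + of_real t * d)) (at 0)"

fun iter_pd :: "complex list \<Rightarrow> (complex \<Rightarrow> complex) \<Rightarrow> complex \<Rightarrow> complex" where
  "iter_pd [] f = f"
| "iter_pd (d # ds) f = pd d (iter_pd ds f)"

text \<open>C^infinity in the real sense: all iterated partial derivatives in u, v exist and
  are (real-, i.e. Frechet-) differentiable.\<close>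
definition smooth_fun :: "(complex \<Rightarrow> complex) \<Rightarrow> bool" where
  "smooth_fun f \<longleftrightarrow> (\<forall>ds. set ds \<subseteq> {1, \<i>} \<longrightarrow> iter_pd ds f differentiable_on UNIV)"

definition test_fun :: "(complex \<Rightarrow> complex) \<Rightarrow> bool" where
  "test_fun \<phi> \<longleftrightarrow> smooth_fun \<phi> \<and> compact (closure {w. \<phi> w \<noteq> 0})
      \<and> closure {w. \<phi> w \<noteq> 0} \<subseteq> ball 0 1"

definition dw :: "(complex \<Rightarrow> complex) \<Rightarrow> complex \<Rightarrow> complex" where
  "dw f z = (pd 1 f z - \<i> * pd \<i> f z) / 2"
definition dwbar :: "(complex \<Rightarrow> complex) \<Rightarrow> complex \<Rightarrow> complex" where
  "dwbar f z = (pd 1 f z + \<i> * pd \<i> f z) / 2"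

definition Dop :: "real \<Rightarrow> (complex \<Rightarrow> complex) \<Rightarrow> complex \<Rightarrow> complex" where
  "Dop k f w = of_real ((1 - (cmod w)\<^sup>2)\<^sup>2) * dw (dwbar f) w
     + of_real k * of_real (1 - (cmod w)\<^sup>2) * w * dw f w
     - of_real k * of_real (1 - (cmod w)\<^sup>2) * cnj w * dwbar f w
     + of_real (- k\<^sup>2 * (cmod w)\<^sup>2 + k\<^sup>2 + 1/4) * f w"

definition Gk :: "real \<Rightarrow> complex \<Rightarrow> complex \<Rightarrow> complex" where
  "Gk k s w = (let y = 1 / (1 - (cmod w)\<^sup>2) in
      Gamma (s - of_real \<bar>k\<bar>) * Gamma (s + of_real \<bar>k\<bar>) / (4 * of_real pi * Gamma (2 * s))
      * (of_real y) powr (- s) * hyp2F1 (s - of_real \<bar>k\<bar>) (s + of_real \<bar>k\<bar>) (2 * s) (of_real (1 / y)))"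

definition hdens :: "complex \<Rightarrow> real" where
  "hdens w = 4 / (1 - (cmod w)\<^sup>2)\<^sup>2"

end

theory Submission
  imports Defs "HOL-Real_Asymp.Real_Asymp"
begin

text \<open>
  On radial functions \<open>g(t)\<close>, \<open>t = |w|\<^sup>2\<close>, the first-order terms of \<open>D\<^sub>k\<close> cancel and
  \<open>(D\<^sub>k + \<lambda>\<^sup>2) g = 0\<close> becomes, with \<open>x = 1 - t = 1/y\<close> and \<open>g = x\<^sup>s F(x)\<close>, the hypergeometric equation
  with parameters \<open>a = s - |k|\<close>, \<open>b = s + |k|\<close>, \<open>c = 2s\<close>. Since \<open>c = a + b\<close>, the coefficients of \<open>F'\<close>
  converge to \<open>\<Gamma>(a+b) / (\<Gamma>(a) \<Gamma>(b))\<close>, so by Abel's theorem \<open>t g'(t)\<close> tends to \<open>-1/(4\<pi>)\<close> as \<open>t\<close> tends to 0: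
  a logarithmic pole. Integrating by parts against \<open>\<chi>(t/\<delta>\<^sup>2) g\<close>, where the cutoff \<open>\<chi>\<close> removes the pole,
  leaves only a term with density \<open>\<chi>'(t/\<delta>\<^sup>2)/\<delta>\<^sup>2\<close>, an approximate identity of total mass \<open>\<pi>\<close>; it is
  integrated against a function tending to \<open>\<phi>(0)/\<pi>\<close> at the origin.
\<close>

subsection \<open>Integration by parts against radial functions\<close>

text \<open>In the integral the operator acts on \<open>\<phi>\<close>, not on the radial function,
  so its first-order terms survive. They combine into a multiple of the derivative along the
  rotation field iw; this field is divergence free and tangent to circles, so the derivative
  integrates to zero against radial weights. The density of hyperbolic area cancels the factor (1 -
  |w|^2)^2 of the second-order part, and everything takes place in the Euclidean plane. Near the
  pole a single weak estimate enters: |w| g(|w|^2) tends to 0, a consequence of t g'(t) being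
  bounded. It yields the integrable majorant const/|w| and also makes the term with the gradient of
  \<open>\<phi>\<close> vanish in the limit, so that t g'(t) alone decides the mass at the origin.
  Cutting off the pole, instead of integrating over small circles, keeps every vector field
  compactly supported; for such fields the divergence theorem is only the translation invariance of
  Lebesgue measure.\<close>

lemma integrable_continuous_cball_support:
  fixes f :: "'a::euclidean_space \<Rightarrow> 'b::{banach,second_countable_topology}"
  assumes "continuous_on UNIV f" and "\<And>w. R \<le> norm w \<Longrightarrow> f w = 0"
  shows "integrable lborel f"
proof -
  have "integrable lborel (\<lambda>w. indicator (cball 0 R) w *\<^sub>R f w)"
    using assms(1) by (intro borel_integrable_compact) (auto intro: continuous_on_subset)
  moreover have "(\<lambda>w. indicator (cball 0 R) w *\<^sub>R f w) = f"
    using assms(2) by (auto simp: indicator_def fun_eq_iff)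
  ultimately show ?thesis by simp
qed

lemma bounded_continuous_cball_support:
  fixes f :: "'a::euclidean_space \<Rightarrow> 'b::real_normed_vector"
  assumes "continuous_on UNIV f" and "\<And>w. R \<le> norm w \<Longrightarrow> f w = 0"
  obtains B where "B > 0" "\<And>w. norm (f w) \<le> B"
proof -
  have "compact (f ` cball 0 R)"
    using assms(1) by (intro compact_continuous_image) (auto intro: continuous_on_subset)
  then have "bounded (f ` cball 0 R)" by (rule compact_imp_bounded)
  then obtain B where B: "B > 0" "\<And>w. w \<in> cball 0 R \<Longrightarrow> norm (f w) \<le> B"
    unfolding bounded_pos by blast
  have "norm (f w) \<le> B" for w
    using B assms(2)[of w] by (cases "norm w \<le> R") auto
  with B(1) show thesis by (rule that)
qed

text \<open>The difference quotients of \<open>V\<close> along \<open>d\<close> have integral zero by translation invariance.\<close>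
lemma has_bochner_integral_directional_derivative:
  fixes V V' :: "'a::euclidean_space \<Rightarrow> 'b::{banach,second_countable_topology}"
  assumes der: "\<And>w. ((\<lambda>t. V (w + t *\<^sub>R d)) has_vector_derivative V' w) (at 0)"
    and cont: "continuous_on UNIV V" "continuous_on UNIV V'"
    and supp: "\<And>w. R \<le> norm w \<Longrightarrow> V w = 0" "\<And>w. R \<le> norm w \<Longrightarrow> V' w = 0"
  shows "has_bochner_integral lborel V' 0"
proof -
  have intV: "integrable lborel V" and intV': "integrable lborel V'"
    using integrable_continuous_cball_support cont supp by blast+
  have [measurable]: "V \<in> borel_measurable borel" "V' \<in> borel_measurable borel"
    using cont by (auto intro: borel_measurable_continuous_onI)
  obtain B where B: "B > 0" "\<And>w. norm (V' w) \<le> B"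
    using bounded_continuous_cball_support[OF cont(2) supp(2)] by blast
  have der': "((\<lambda>t. V (w + t *\<^sub>R d)) has_vector_derivative V' (w + u *\<^sub>R d)) (at u)" for w u
  proof -
    have "((\<lambda>t. V ((w + u *\<^sub>R d) + t *\<^sub>R d)) \<circ> (\<lambda>t. t - u) has_vector_derivative 1 *\<^sub>R V' (w + u *\<^sub>R d)) (at u)"
      using der[of "w + u *\<^sub>R d"]
      by (intro vector_diff_chain_at) (auto intro!: derivative_eq_intros)
    then show ?thesis by (simp add: o_def algebra_simps)
  qed
  have shift: "norm (V (w + h *\<^sub>R d) - V w) \<le> B * h" if "h > 0" for w h
  proof -
    have c: "continuous_on {0..h} (\<lambda>t. V (w + t *\<^sub>R d))"
      using der' has_vector_derivative_continuous by (blast intro: continuous_at_imp_continuous_on)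
    have "norm (V (w + h *\<^sub>R d) - V (w + 0 *\<^sub>R d)) \<le> B * h - B * 0"
      using B by (intro differentiable_bound_general[where f'="\<lambda>t. V' (w + t *\<^sub>R d)" and \<phi>'="\<lambda>_. B"] der' that c)
        (auto intro!: continuous_intros derivative_eq_intros)
    then show ?thesis by simp
  qed
  define h where "h n = 1 / real (Suc n)" for n
  have h: "h n > 0" "h n \<le> 1" for n by (auto simp: h_def field_simps)
  have hlim: "h \<longlonglongrightarrow> 0" unfolding h_def by (rule LIMSEQ_Suc[OF lim_1_over_n])
  define Q where "Q n w = (1 / h n) *\<^sub>R (V (w + h n *\<^sub>R d) - V w)" for n w
  have trans: "integrable lborel (\<lambda>w. V (w + c))" "(\<integral>w. V (w + c) \<partial>lborel) = (\<integral>w. V w \<partial>lborel)" for c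
  proof -
    have eq: "distr lborel borel (\<lambda>w. w + c) = (lborel :: 'a measure)"
      using lborel_affine[of 1 c] by (simp add: density_1 add.commute)
    show "integrable lborel (\<lambda>w. V (w + c))"
      using intV integrable_distr_eq[of "\<lambda>w. w + c" lborel borel V] unfolding eq by simp
    show "(\<integral>w. V (w + c) \<partial>lborel) = (\<integral>w. V w \<partial>lborel)"
      using integral_distr[of "\<lambda>w. w + c" lborel borel V] unfolding eq by simp
  qed
  have Q0: "(\<integral>w. Q n w \<partial>lborel) = 0" for n
    unfolding Q_def using trans intV by (simp del: divide_const_simps)
  have "(\<lambda>n. \<integral>w. Q n w \<partial>lborel) \<longlonglongrightarrow> (\<integral>w. V' w \<partial>lborel)"
  proof (rule integral_dominated_convergence)
    \<comment> \<open>The increments \<open>h n\<close> are at most 1, so all difference quotients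
      vanish outside this enlarged ball; inside it the mean value bound \<open>shift\<close> gives
      \<open>B\<close>. The absolute value covers a negative \<open>R\<close>.\<close>
    show "integrable lborel (\<lambda>w. indicator (cball 0 (\<bar>R\<bar> + norm d)) w *\<^sub>R B :: real)"
      by (intro borel_integrable_compact) auto
    show "AE w in lborel. (\<lambda>n. Q n w) \<longlonglongrightarrow> V' w"
    proof (rule AE_I2)
      fix w
      have "(\<lambda>t. norm (V (w + t *\<^sub>R d) - V w - t *\<^sub>R V' w) / norm t) \<midarrow>0\<rightarrow> 0"
        using der[of w] by (simp add: has_vector_derivative_def has_derivative_at)
      moreover have "filterlim h (at 0) sequentially"
        using hlim h(1) by (intro filterlim_atI) (auto simp: less_imp_neq[symmetric])
      ultimately have "(\<lambda>n. norm (V (w + h n *\<^sub>R d) - V w - h n *\<^sub>R V' w) / norm (h n)) \<longlonglongrightarrow> 0"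
        by (rule filterlim_compose)
      moreover have "norm (V (w + h n *\<^sub>R d) - V w - h n *\<^sub>R V' w) / norm (h n) = norm (Q n w - V' w)" for n
      proof -
        have "Q n w - V' w = (1 / h n) *\<^sub>R (V (w + h n *\<^sub>R d) - V w - h n *\<^sub>R V' w)"
          using h(1)[of n] by (simp add: Q_def algebra_simps)
        then show ?thesis by (simp add: divide_inverse mult.commute)
      qed
      ultimately show "(\<lambda>n. Q n w) \<longlonglongrightarrow> V' w"
        by (simp add: tendsto_norm_zero_iff LIM_zero_iff)
    qed
    show "AE w in lborel. norm (Q n w) \<le> indicator (cball 0 (\<bar>R\<bar> + norm d)) w *\<^sub>R B" for n
    proof (rule AE_I2)
      fix w
      show "norm (Q n w) \<le> indicator (cball 0 (\<bar>R\<bar> + norm d)) w *\<^sub>R B"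
      proof (cases "w \<in> cball 0 (\<bar>R\<bar> + norm d)")
        case True
        have "norm (Q n w) = norm (V (w + h n *\<^sub>R d) - V w) / h n"
          unfolding Q_def norm_scaleR using h(1)[of n] by simp
        then show ?thesis using True shift[OF h(1)[of n], of w] h(1)[of n] by (simp add: pos_divide_le_eq)
      next
        case False
        have "norm (h n *\<^sub>R d) \<le> norm d"
          using h[of n] by (simp add: mult_left_le_one_le)
        moreover have "norm w \<le> norm (w + h n *\<^sub>R d) + norm (h n *\<^sub>R d)"
          by (metis add_diff_cancel norm_triangle_ineq4)
        ultimately have "R \<le> norm w" "R \<le> norm (w + h n *\<^sub>R d)"
          using False norm_ge_zero[of d] abs_ge_self[of R] unfolding mem_cball_0 by linarith+
        then show ?thesis using supp False by (simp add: Q_def)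
      qed
    qed
  qed (auto simp: Q_def[abs_def])
  then have "(\<integral>w. V' w \<partial>lborel) = 0"
    by (simp add: Q0 LIMSEQ_const_iff)
  with intV' show ?thesis by (simp add: has_bochner_integral_iff)
qed

text \<open>Radial coefficients are controlled only in the open unit disc. A product that vanishes
  beyond a radius below 1 is continuous on two open sets covering the plane, hence
  everywhere.\<close>

lemma continuous_on_UNIV_vanishing:
  fixes f :: "'a::real_normed_vector \<Rightarrow> 'b::real_normed_vector"
  assumes f: "continuous_on (ball 0 1) f" and R: "R < 1" and zero: "\<And>w. R \<le> norm w \<Longrightarrow> f w = 0"
  shows "continuous_on UNIV f"
proof -
  define S where "S = max R 0"
  have S: "S < 1" "R \<le> S" using R by (auto simp: S_def)
  have "ball 0 1 \<union> - cball 0 S = (UNIV :: 'a set)" using S by auto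
  moreover have "continuous_on (- cball 0 S) f"
    using zero S by (auto intro!: continuous_on_eq[OF continuous_on_const[of _ 0]])
  moreover have "open (ball (0::'a) 1)" "open (- cball (0::'a) S)" by auto
  ultimately show ?thesis using continuous_on_open_Un[OF _ _ f] by metis
qed

text \<open>The divergence theorem for the vector field \<open>A(|w|\<^sup>2) \<psi>(w) d\<close>.\<close>
lemma radial_integration_by_parts:
  fixes A A' :: "real \<Rightarrow> complex" and \<psi> \<psi>' :: "complex \<Rightarrow> complex"
  assumes A: "\<And>t. t < 1 \<Longrightarrow> (A has_vector_derivative A' t) (at t)" "continuous_on {..<1} A'"
    and \<psi>: "\<And>w. ((\<lambda>t. \<psi> (w + of_real t * d)) has_vector_derivative \<psi>' w) (at 0)"
      "continuous_on UNIV \<psi>" "continuous_on UNIV \<psi>'"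
    and supp: "R < 1" "\<And>w. R \<le> cmod w \<Longrightarrow> \<psi> w = 0" "\<And>w. R \<le> cmod w \<Longrightarrow> \<psi>' w = 0"
  shows "has_bochner_integral lborel
    (\<lambda>w. A ((cmod w)\<^sup>2) * \<psi>' w + 2 * of_real (w \<bullet> d) * A' ((cmod w)\<^sup>2) * \<psi> w) 0"
proof (rule has_bochner_integral_directional_derivative[where V="\<lambda>w. A ((cmod w)\<^sup>2) * \<psi> w" and d=d])
  have cA: "continuous_on {..<1} A"
    by (intro continuous_at_imp_continuous_on ballI has_vector_derivative_continuous[OF A(1)]) simp
  note extend = continuous_on_UNIV_vanishing[OF _ supp(1)]
  have comp: "continuous_on (ball 0 1) (\<lambda>w::complex. f ((cmod w)\<^sup>2))" if "continuous_on {..<1} f" for f :: "real \<Rightarrow> complex"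
    by (rule continuous_on_compose2[OF that]) (auto intro!: continuous_intros simp: abs_square_less_1)
  have c\<psi>: "continuous_on (ball 0 1) \<psi>" "continuous_on (ball 0 1) \<psi>'"
    using \<psi>(2,3) by (auto intro: continuous_on_subset)
  show "continuous_on UNIV (\<lambda>w. A ((cmod w)\<^sup>2) * \<psi> w)"
    by (rule extend) (auto intro!: continuous_intros comp cA c\<psi> simp: supp)
  show "continuous_on UNIV (\<lambda>w. A ((cmod w)\<^sup>2) * \<psi>' w + 2 * of_real (w \<bullet> d) * A' ((cmod w)\<^sup>2) * \<psi> w)"
    by (rule extend) (auto intro!: continuous_intros comp cA A(2) c\<psi> simp: supp)
  show "((\<lambda>t. A ((cmod (w + t *\<^sub>R d))\<^sup>2) * \<psi> (w + t *\<^sub>R d)) has_vector_derivative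
      A ((cmod w)\<^sup>2) * \<psi>' w + 2 * of_real (w \<bullet> d) * A' ((cmod w)\<^sup>2) * \<psi> w) (at 0)" for w
  proof (cases "cmod w < 1")
    case True
    have sq: "(cmod (w + t *\<^sub>R d))\<^sup>2 = (cmod w)\<^sup>2 + 2 * (w \<bullet> d) * t + (cmod d)\<^sup>2 * t\<^sup>2" for t
      by (simp only: power2_norm_eq_inner inner_add_left inner_add_right inner_scaleR_left inner_scaleR_right
          inner_commute[of d w]) (simp add: algebra_simps power2_eq_square)
    have 1: "((\<lambda>t. (cmod (w + t *\<^sub>R d))\<^sup>2) has_vector_derivative 2 * (w \<bullet> d)) (at 0)"
      unfolding sq has_real_derivative_iff_has_vector_derivative[symmetric]
      by (auto intro!: derivative_eq_intros)
    have 2: "(A has_vector_derivative A' ((cmod (w + 0 *\<^sub>R d))\<^sup>2)) (at ((cmod (w + 0 *\<^sub>R d))\<^sup>2))"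
      using True by (intro A(1)) (simp add: abs_square_less_1)
    have "((\<lambda>t. A ((cmod (w + t *\<^sub>R d))\<^sup>2)) has_vector_derivative (2 * (w \<bullet> d)) *\<^sub>R A' ((cmod w)\<^sup>2)) (at 0)"
      using vector_diff_chain_at[OF 1 2] by (simp add: o_def)
    from has_vector_derivative_mult[OF this \<psi>(1)[of w]] show ?thesis
      by (simp add: scaleR_conv_of_real mult_ac)
  next
    case False
    \<comment> \<open>Nothing is assumed about \<open>A\<close> from 1 on. The product is
      differentiable here because it is identically zero near \<open>w\<close>.\<close>
    then have "w \<in> - cball 0 R" using supp(1) by auto
    moreover have "((\<lambda>t. w + t *\<^sub>R d) \<longlongrightarrow> w + 0 *\<^sub>R d) (at 0)" by (intro tendsto_intros)
    ultimately have ev: "\<forall>\<^sub>F t in at 0. w + t *\<^sub>R d \<in> - cball 0 R"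
      by (intro topological_tendstoD) auto
    have "((\<lambda>t. 0 :: complex) has_vector_derivative 0) (at 0)" by simp
    then have "((\<lambda>t. A ((cmod (w + t *\<^sub>R d))\<^sup>2) * \<psi> (w + t *\<^sub>R d)) has_vector_derivative 0) (at 0)"
      unfolding has_vector_derivative_def
      by (rule has_derivative_transform_eventually)
        (use ev False supp in \<open>auto elim!: eventually_mono\<close>)
    then show ?thesis using False supp by simp
  qed
  show "R \<le> cmod w \<Longrightarrow> A ((cmod w)\<^sup>2) * \<psi> w = 0" 
    "R \<le> cmod w \<Longrightarrow> A ((cmod w)\<^sup>2) * \<psi>' w + 2 * of_real (w \<bullet> d) * A' ((cmod w)\<^sup>2) * \<psi> w = 0" for w
    using supp by auto
qed

subsection \<open>Radial integrals and the cutoff\<close>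

text \<open>A disc of radius r has area pi r^2, so area pushed forward by |w|^2 is pi times length
  on the half-line: polar coordinates for radial integrands.\<close>

lemma nn_integral_norm_square:
  fixes f :: "real \<Rightarrow> ennreal"
  assumes [measurable]: "f \<in> borel_measurable borel"
  shows "(\<integral>\<^sup>+ w. f ((cmod w)\<^sup>2) \<partial>lborel) = pi * (\<integral>\<^sup>+ t. f t * indicator {0..} t \<partial>lborel)"
proof -
  \<comment> \<open>Measures are compared on the rays \<open>{x<..}\<close>, which must have finite
    mass. The minus sign turns the preimages of these rays into discs.\<close>
  have eq: "distr lborel borel (\<lambda>w. - (cmod w)\<^sup>2) = density lborel (\<lambda>t. ennreal pi * indicator {..0} t)"
  proof (rule measure_eqI_lessThan)
    have em: "emeasure (distr lborel borel (\<lambda>w. - (cmod w)\<^sup>2)) {x<..} = ennreal (pi * max 0 (- x))" for x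
    proof -
      have "(\<lambda>w. - (cmod w)\<^sup>2) -` {x<..} = ball 0 (sqrt (max 0 (- x)))"
        by (auto simp: real_less_rsqrt real_sqrt_less_iff max_def)
           (smt (verit) real_sqrt_abs abs_norm_cancel real_sqrt_less_iff real_less_rsqrt sqrt_le_D zero_le_power2)+
      then have "emeasure (distr lborel borel (\<lambda>w. - (cmod w)\<^sup>2)) {x<..} = emeasure lborel (ball (0::complex) (sqrt (max 0 (- x))))"
        by (simp add: emeasure_distr)
      then show ?thesis by (simp add: emeasure_ball unit_ball_vol_2)
    qed
    then show "emeasure (distr lborel borel (\<lambda>w. - (cmod w)\<^sup>2)) {x<..} < \<infinity>" for x by simp
    show "emeasure (distr lborel borel (\<lambda>w. - (cmod w)\<^sup>2)) {x<..} =
      emeasure (density lborel (\<lambda>t. ennreal pi * indicator {..0} t)) {x<..}" for x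
    proof -
      have "emeasure (density lborel (\<lambda>t. ennreal pi * indicator {..0} t)) {x<..}
        = (\<integral>\<^sup>+t. ennreal pi * indicator {x<..0} t \<partial>lborel)"
        by (subst emeasure_density) (auto intro!: nn_integral_cong simp: indicator_def)
      also have "\<dots> = ennreal (pi * max 0 (- x))"
        by (subst nn_integral_cmult_indicator) (auto simp: ennreal_mult max_def)
      finally show ?thesis using em by simp
    qed
  qed auto
  have "(\<integral>\<^sup>+ w. f ((cmod w)\<^sup>2) \<partial>lborel) = (\<integral>\<^sup>+ t. f (- t) \<partial>distr lborel borel (\<lambda>w. - (cmod w)\<^sup>2))"
    by (subst nn_integral_distr) auto
  also have "\<dots> = (\<integral>\<^sup>+ t. pi * (f (- t) * indicator {..0} t) \<partial>lborel)"
    unfolding eq by (subst nn_integral_density) (auto simp: mult_ac)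
  also have "\<dots> = pi * (\<integral>\<^sup>+ t. f (- t) * indicator {..0} t \<partial>lborel)"
    by (rule nn_integral_cmult) auto
  also have "(\<integral>\<^sup>+ t. f (- t) * indicator {..0} t \<partial>lborel) = (\<integral>\<^sup>+ t. f t * indicator {0..} t \<partial>lborel)"
    by (subst nn_integral_real_affine[where c="-1" and t=0]) (auto intro!: nn_integral_cong simp: indicator_def)
  finally show ?thesis .
qed

text \<open>In the variable \<open>t = |w|\<^sup>2\<close>, \<open>cutoff (t / \<delta>\<^sup>2)\<close> vanishes on the disc of radius \<open>\<delta>\<close>. The third power makes it
  \<open>C\<^sup>2\<close>, which the two integrations by parts in \<open>radial_mixed_partials\<close> below need.\<close>
definition cutoff :: "real \<Rightarrow> real" where
  "cutoff t = (if t \<le> 1 then 0 else (1 - 1 / t) ^ 3)"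
definition cutoff' :: "real \<Rightarrow> real" where
  "cutoff' t = (if t \<le> 1 then 0 else 3 * (1 - 1 / t)\<^sup>2 / t\<^sup>2)"
definition cutoff'' :: "real \<Rightarrow> real" where
  "cutoff'' t = (if t \<le> 1 then 0 else 6 * (1 - 1 / t) / t ^ 4 - 6 * (1 - 1 / t)\<^sup>2 / t ^ 3)"

text \<open>The formula is differentiable across the junction, and its value and slope there agree
  with those of the zero function. The triple zero of the cutoff at 1 allows two
  applications.\<close>

lemma has_real_derivative_extend_by_zero:
  fixes f f' :: "real \<Rightarrow> real"
  assumes f: "\<And>t. c \<le> t \<Longrightarrow> (f has_real_derivative f' t) (at t)" and "f c = 0" "f' c = 0"
  shows "((\<lambda>t. if t \<le> c then 0 else f t) has_real_derivative (if t \<le> c then 0 else f' t)) (at t)"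
proof -
  have "((\<lambda>t. if t \<in> {..c} then 0 else f t) has_vector_derivative
      (if t \<in> {..c} then 0 else f' t)) (at t within UNIV)"
  proof (rule has_vector_derivative_If_within_closures[where T="{c<..}"])
    assume "t \<in> {c<..} \<union> (closure {..c} \<inter> closure {c<..})"
    then have "c \<le> t" by auto
    then show "(f has_vector_derivative f' t) (at t within {c<..} \<union> (closure {..c} \<inter> closure {c<..}))"
      using f has_real_derivative_iff_has_vector_derivative has_vector_derivative_at_within by blast
  qed (use assms in auto)
  then show ?thesis
    by (simp add: has_real_derivative_iff_has_vector_derivative)
qed

lemma has_real_derivative_cutoff: "(cutoff has_real_derivative cutoff' t) (at t)"
  unfolding cutoff_def[abs_def] cutoff'_def
  by (rule has_real_derivative_extend_by_zero)
    (auto intro!: derivative_eq_intros simp: power2_eq_square)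

lemma has_real_derivative_cutoff': "(cutoff' has_real_derivative cutoff'' t) (at t)"
  unfolding cutoff'_def[abs_def] cutoff''_def
  by (rule has_real_derivative_extend_by_zero)
    (auto intro!: derivative_eq_intros simp: field_simps eval_nat_numeral)

lemma continuous_on_cutoff'': "continuous_on UNIV cutoff''"
proof -
  have "continuous_on ({..1} \<union> {1..}) (\<lambda>t::real. if t \<le> 1 then 0 else 6 * (1 - 1 / t) / t ^ 4 - 6 * (1 - 1 / t)\<^sup>2 / t ^ 3)"
    by (rule continuous_on_cases) (auto intro!: continuous_intros)
  moreover have "{..1} \<union> {1..} = (UNIV :: real set)" by auto
  ultimately show ?thesis by (simp add: cutoff''_def[abs_def])
qed

lemma cutoff'_nonneg: "0 \<le> cutoff' t"
  by (simp add: cutoff'_def)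

lemma cutoff_bounds: "0 \<le> cutoff t" "cutoff t \<le> 1"
  by (auto simp: cutoff_def intro!: power_le_one)

text \<open>In the variable t = |w|^2 the integral is pi times the total increase of
  \<open>cutoff\<close>. The cutoff reaches 1 only in the limit at infinity, so the fundamental
  theorem is applied on a half-line.\<close>

lemma has_bochner_integral_cutoff': "has_bochner_integral lborel (\<lambda>w. cutoff' ((cmod w)\<^sup>2)) pi"
proof -
  have [measurable]: "cutoff' \<in> borel_measurable borel"
    unfolding cutoff'_def[abs_def] by measurable
  have "(cutoff \<longlongrightarrow> 1) at_top"
  proof (rule Lim_transform_eventually)
    show "((\<lambda>t::real. (1 - 1 / t) ^ 3) \<longlongrightarrow> 1) at_top" by real_asymp
    show "\<forall>\<^sub>F t in at_top. (1 - 1 / t) ^ 3 = cutoff t"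
      using eventually_gt_at_top[of 1] by eventually_elim (simp add: cutoff_def)
  qed
  then have "(\<integral>\<^sup>+t. ennreal (cutoff' t) * indicator {0..} t \<partial>lborel) = 1 - cutoff 0"
    by (intro nn_integral_FTC_atLeast has_real_derivative_cutoff cutoff'_nonneg) auto
  then have "(\<integral>\<^sup>+ w. cutoff' ((cmod w)\<^sup>2) \<partial>lborel) = ennreal pi"
    by (subst nn_integral_norm_square[where f="\<lambda>t. ennreal (cutoff' t)"]) (auto simp: cutoff_def)
  then show ?thesis
    by (intro has_bochner_integral_nn_integral) (auto simp: cutoff'_nonneg)
qed

text \<open>This is the majorant for the Green function at its pole. In the variable t = |w|^2 it
  becomes t^(-1/2) on the unit interval, with integral 2.\<close>

lemma integrable_inverse_norm:
  "integrable lborel (\<lambda>w. indicator (cball 0 1) w / cmod w)"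
proof (rule integrableI_nonneg)
  have "((\<lambda>t. t powr (-1/2)) has_integral (1 powr (-1/2 + 1) / (-1/2 + 1))) {0..1::real}"
    by (rule has_integral_powr_from_0) auto
  then have "(\<integral>\<^sup>+t. ennreal (t powr (-1/2)) * indicator {0..1::real} t \<partial>lborel) = ennreal 2"
    by (subst nn_integral_has_integral_lebesgue') auto
  then have f: "(\<integral>\<^sup>+t. ennreal (indicator {0..1} t * t powr (-1/2)) * indicator {0..} t \<partial>lborel) = ennreal 2"
    by (subst (asm) nn_integral_cong) (auto simp: indicator_def)
  have "(\<integral>\<^sup>+ w. ennreal (indicator (cball 0 1) w / cmod w) \<partial>lborel)
     = (\<integral>\<^sup>+ w. ennreal (indicator {0..1} ((cmod w)\<^sup>2) * ((cmod w)\<^sup>2) powr (-1/2)) \<partial>lborel)"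
  proof (rule nn_integral_cong)
    fix w :: complex
    \<comment> \<open>This includes \<open>w = 0\<close>, where both sides take the default value
      0.\<close>
    have "((cmod w)\<^sup>2) powr (-1/2) = 1 / cmod w"
      by (simp add: powr_minus powr_half_sqrt inverse_eq_divide)
    then show "ennreal (indicator (cball 0 1) w / cmod w) = ennreal (indicator {0..1} ((cmod w)\<^sup>2) * ((cmod w)\<^sup>2) powr (-1/2))"
      by (auto simp: indicator_def abs_square_le_1)
  qed
  also have "\<dots> = pi * ennreal 2"
  proof -
    have "(\<lambda>t. ennreal (indicator {0..1} t * t powr (-1/2))) \<in> borel_measurable borel"
      by measurable
    from nn_integral_norm_square[OF this] show ?thesis unfolding f .
  qed
  finally show "(\<integral>\<^sup>+ w. ennreal (indicator (cball 0 1) w / cmod w) \<partial>lborel) < \<infinity>"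
    by (simp add: ennreal_mult_less_top)
  have [measurable]: "cball (0::complex) 1 \<in> sets borel" by auto
  show "(\<lambda>w. indicator (cball 0 1) w / cmod w) \<in> borel_measurable lborel" by measurable
qed auto

text \<open>The substitution \<open>w = \<delta> z\<close> turns the left-hand side into an integral against a fixed density.\<close>
lemma tendsto_integral_cutoff':
  fixes q :: "complex \<Rightarrow> complex" and q0 :: complex and \<delta> :: "nat \<Rightarrow> real"
  assumes [measurable]: "q \<in> borel_measurable borel"
    and bd: "\<And>w. norm (q w) \<le> C"
    and lim: "(q \<longlongrightarrow> q0) (at 0)"
    and \<delta>: "\<And>n. \<delta> n > 0" "\<delta> \<longlonglongrightarrow> 0"
  shows "(\<lambda>n. \<integral>w. of_real (cutoff' ((cmod w)\<^sup>2 / (\<delta> n)\<^sup>2) / (\<delta> n)\<^sup>2) * q w \<partial>lborel) \<longlonglongrightarrow> pi * q0"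
proof -
  have [measurable]: "cutoff' \<in> borel_measurable borel"
    unfolding cutoff'_def[abs_def] by measurable
  have scale: "(\<integral>w. of_real (cutoff' ((cmod w)\<^sup>2 / d\<^sup>2) / d\<^sup>2) * q w \<partial>lborel) = (\<integral>w. of_real (cutoff' ((cmod w)\<^sup>2)) * q (d *\<^sub>R w) \<partial>lborel)"
    if d: "d > 0" for d
  proof -
    have "(\<integral>w. of_real (cutoff' ((cmod w)\<^sup>2 / d\<^sup>2) / d\<^sup>2) * q w \<partial>lborel) =
      (\<integral>w. of_real (cutoff' ((cmod w)\<^sup>2 / d\<^sup>2) / d\<^sup>2) * q w \<partial>density (distr lborel borel (\<lambda>w. 0 + d *\<^sub>R w)) (\<lambda>_. \<bar>d\<bar> ^ DIM(complex)))"
      using lborel_affine[of d "0::complex"] d by simp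
    also have "\<dots> = (\<integral>w. d\<^sup>2 *\<^sub>R (of_real (cutoff' ((cmod w)\<^sup>2 / d\<^sup>2) / d\<^sup>2) * q w) \<partial>distr lborel borel (\<lambda>w. 0 + d *\<^sub>R w))"
      by (subst integral_density) auto
    also have "\<dots> = (\<integral>w. d\<^sup>2 *\<^sub>R (of_real (cutoff' ((cmod (0 + d *\<^sub>R w))\<^sup>2 / d\<^sup>2) / d\<^sup>2) * q (0 + d *\<^sub>R w)) \<partial>lborel)"
      by (rule integral_distr) auto
    also have "\<dots> = (\<integral>w. of_real (cutoff' ((cmod w)\<^sup>2)) * q (d *\<^sub>R w) \<partial>lborel)"
      using d by (intro Bochner_Integration.integral_cong) (auto simp: power_mult_distrib scaleR_conv_of_real norm_mult)
    finally show ?thesis .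
  qed
  have lim: "(\<lambda>n. \<integral>w. complex_of_real (cutoff' ((cmod w)\<^sup>2)) * q (\<delta> n *\<^sub>R w) \<partial>lborel) \<longlonglongrightarrow>
     (\<integral>w. complex_of_real (cutoff' ((cmod w)\<^sup>2)) * q0 \<partial>lborel)"
  proof (rule integral_dominated_convergence)
    show "integrable lborel (\<lambda>w. cutoff' ((cmod w)\<^sup>2) * C)"
      using has_bochner_integral_cutoff' by (auto simp: has_bochner_integral_iff)
    show "AE w in lborel. norm (complex_of_real (cutoff' ((cmod w)\<^sup>2)) * q (\<delta> n *\<^sub>R w)) \<le> cutoff' ((cmod w)\<^sup>2) * C" for n
      using bd cutoff'_nonneg by (auto simp: norm_mult intro!: mult_left_mono)
    have "(\<lambda>n. complex_of_real (cutoff' ((cmod w)\<^sup>2)) * q (\<delta> n *\<^sub>R w)) \<longlonglongrightarrow> complex_of_real (cutoff' ((cmod w)\<^sup>2)) * q0" for w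
    proof (cases "w = 0")
      case True
      \<comment> \<open>The limit of \<open>q\<close> says nothing about its value at the origin,
        but the density vanishes there.\<close>
      then show ?thesis by (simp add: cutoff'_def)
    next
      case False
      have "filterlim (\<lambda>n. \<delta> n *\<^sub>R w) (at 0) sequentially"
      proof (rule filterlim_atI)
        show "(\<lambda>n. \<delta> n *\<^sub>R w) \<longlonglongrightarrow> 0" using tendsto_scaleR[OF \<delta>(2) tendsto_const, of w] by simp
        show "\<forall>\<^sub>F n in sequentially. \<delta> n *\<^sub>R w \<noteq> 0" using False \<delta>(1) by (auto simp: less_imp_neq[symmetric])
      qed
      from filterlim_compose[OF lim this] show ?thesis by (intro tendsto_intros)
    qed
    then show "AE w in lborel. (\<lambda>n. complex_of_real (cutoff' ((cmod w)\<^sup>2)) * q (\<delta> n *\<^sub>R w)) \<longlonglongrightarrow> complex_of_real (cutoff' ((cmod w)\<^sup>2)) * q0"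
      by simp
  qed auto
  have val: "(\<integral>w. complex_of_real (cutoff' ((cmod w)\<^sup>2)) * q0 \<partial>lborel) = pi * q0"
    using has_bochner_integral_cutoff' by (simp add: has_bochner_integral_iff)
  show ?thesis
    using lim unfolding scale[OF \<delta>(1)] val .
qed

subsection \<open>The hypergeometric function near 1\<close>

definition hyp_coeff :: "complex \<Rightarrow> complex \<Rightarrow> complex \<Rightarrow> nat \<Rightarrow> complex" where
  "hyp_coeff a b c n = pochhammer a n * pochhammer b n / (pochhammer c n * fact n)"

lemma hyp2F1_eq: "hyp2F1 a b c = (\<lambda>z. \<Sum>n. hyp_coeff a b c n * z ^ n)"
  unfolding hyp2F1_def hyp_coeff_def ..

lemma nonpos_Ints_plus_of_nat_nonzero:
  fixes c :: complex
  assumes "c \<notin> \<int>\<^sub>\<le>\<^sub>0" shows "c + of_nat n \<noteq> 0"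
  using assms plus_of_nat_eq_0_imp by blast

text \<open>The ratio of consecutive coefficients, cleared of denominators. Summed against the
  powers of z, it becomes the hypergeometric equation.\<close>

lemma hyp_coeff_Suc:
  assumes "c \<notin> \<int>\<^sub>\<le>\<^sub>0"
  shows "(c + of_nat n) * diffs (hyp_coeff a b c) n = (a + of_nat n) * (b + of_nat n) * hyp_coeff a b c n"
proof -
  have "(1 + of_nat n :: complex) \<noteq> 0"
    by (metis of_nat_Suc of_nat_neq_0)
  moreover have "N \<noteq> 0 \<Longrightarrow> z \<noteq> 0 \<Longrightarrow> z * (N * (pa * x * (pb * y) / (pc * z * (N * f)))) = x * y * (pa * pb / (pc * f))"
    for N z pa pb pc x y f :: complex
    by (simp add: field_simps)
  ultimately show ?thesis
    using nonpos_Ints_plus_of_nat_nonzero[OF assms, of n]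
    by (simp add: hyp_coeff_def diffs_def pochhammer_Suc)
qed

text \<open>Each term is exactly a quotient of three Gauss products (z)_(n+1) / (n! n^z), which
  converge to the reciprocal Gamma function. The condition c = a + b is what makes the powers n^a,
  n^b and n^c cancel.\<close>

lemma diffs_hyp_coeff_tendsto:
  assumes "a + b \<notin> \<int>\<^sub>\<le>\<^sub>0"
  shows "diffs (hyp_coeff a b (a + b)) \<longlonglongrightarrow> rGamma a * rGamma b / rGamma (a + b)"
proof -
  have "diffs (hyp_coeff a b (a + b)) n = rGamma_series a n * rGamma_series b n / rGamma_series (a + b) n" for n
  proof -
    have N: "(1 + of_nat n :: complex) \<noteq> 0"
      by (metis of_nat_Suc of_nat_neq_0)
    have "N \<noteq> 0 \<Longrightarrow> x \<noteq> 0 \<Longrightarrow> y \<noteq> 0 \<Longrightarrow> f \<noteq> 0 \<Longrightarrow>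
        N * (p * q / (r * (N * f))) = p / (f * x) * (q / (f * y)) / (r / (f * (x * y)))"
      for N p q r f x y :: complex
      by (simp add: field_simps)
    note alg = this
    have "diffs (hyp_coeff a b (a + b)) n = (1 + of_nat n) * (pochhammer a (Suc n) * pochhammer b (Suc n) /
        (pochhammer (a + b) (Suc n) * ((1 + of_nat n) * fact n)))"
      unfolding hyp_coeff_def diffs_def by simp
    also have "\<dots> = rGamma_series a n * rGamma_series b n / rGamma_series (a + b) n"
      unfolding rGamma_series_def distrib_right[of a b] exp_add Suc_eq_plus1[symmetric]
      by (rule alg) (use N in auto)
    finally show ?thesis .
  qed
  moreover have "rGamma (a + b) \<noteq> 0"
    using assms by (simp add: rGamma_eq_zero_iff)
  ultimately have "(\<lambda>n. diffs (hyp_coeff a b (a + b)) n) \<longlonglongrightarrow> rGamma a * rGamma b / rGamma (a + b)"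
    by (simp only: not_False_eq_True) (intro tendsto_intros)
  then show ?thesis .
qed

text \<open>The preceding limit bounds (n+1) times the coefficient of index n+1, hence all
  coefficients, and a geometric series dominates.\<close>

lemma summable_hyp_coeff:
  assumes "a + b \<notin> \<int>\<^sub>\<le>\<^sub>0" "norm z < 1"
  shows "summable (\<lambda>n. hyp_coeff a b (a + b) n * z ^ n)"
proof -
  let ?h = "hyp_coeff a b (a + b)"
  have "Bseq (diffs ?h)"
    using diffs_hyp_coeff_tendsto[OF assms(1)] by (auto intro: convergent_imp_Bseq convergentI)
  then obtain M where M: "\<And>n. norm (diffs ?h n) \<le> M"
    by (auto simp: Bseq_def)
  have "norm (?h n) \<le> max M (norm (?h 0))" for n
  proof (cases n)
    case (Suc m)
    have "norm (?h (Suc m)) * 1 \<le> norm (?h (Suc m)) * real (Suc m)"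
      by (intro mult_left_mono) auto
    also have "\<dots> = norm (diffs ?h m)"
      by (simp add: diffs_def norm_mult mult.commute del: of_nat_Suc)
    finally show ?thesis using M[of m] Suc by simp
  qed simp
  then have "summable (\<lambda>n. norm (?h n) * norm z ^ n)"
    using assms(2) by (intro Abel_lemma[of _ 1 _ "max M (norm (?h 0))"]) auto
  then have "summable (\<lambda>n. norm (?h n * z ^ n))"
    by (simp add: norm_mult norm_power)
  then show ?thesis by (rule summable_norm_cancel)
qed

text \<open>The weights (1 - x) x^n have sum 1 and move to infinity as x tends to 1, so the weighted
  mean tends to the limit of the sequence. In the proof the finitely many early errors contribute at
  most (1 - x) E, the remaining ones at most e/2.\<close>

lemma abel_tendsto_at_left:
  fixes d :: "nat \<Rightarrow> complex"
  assumes lim: "d \<longlonglongrightarrow> L"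
  shows "((\<lambda>x::real. (1 - x) *\<^sub>R (\<Sum>n. d n * of_real x ^ n)) \<longlongrightarrow> L) (at_left 1)"
proof (rule tendstoI)
  fix e :: real assume e: "e > 0"
  define f where "f n = d n - L" for n
  have "f \<longlonglongrightarrow> 0" using lim unfolding f_def by (rule LIM_zero)
  then obtain N where N: "\<And>n. n \<ge> N \<Longrightarrow> norm (f n) < e / 2"
    using e by (metis LIMSEQ_iff half_gt_zero diff_zero)
  define E where "E = (\<Sum>n<N. norm (f n))"
  have "E \<ge> 0" by (auto simp: E_def intro: sum_nonneg)
  have bound: "norm ((1 - x) *\<^sub>R (\<Sum>n. d n * of_real x ^ n) - L) \<le> (1 - x) * E + e / 2"
    if x: "0 < x" "x < 1" for x :: real
  proof -
    have s1: "(\<lambda>n. (if n < N then norm (f n) else 0)) sums E"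
      using sums_If_finite_set[of "{..<N}" "\<lambda>n. norm (f n)"] by (simp add: E_def)
    have s2: "(\<lambda>n. e / 2 * x ^ n) sums (e / 2 * (1 / (1 - x)))"
      using x by (intro sums_mult geometric_sums) auto
    have s3: "(\<lambda>n. (if n < N then norm (f n) else 0) + e / 2 * x ^ n) sums (E + e / 2 * (1 / (1 - x)))"
      by (rule sums_add[OF s1 s2])
    have le: "norm (f n * of_real x ^ n) \<le> (if n < N then norm (f n) else 0) + e / 2 * x ^ n" for n
    proof (cases "n < N")
      case True
      have "norm (f n) * x ^ n \<le> norm (f n) * 1"
        using x by (intro mult_left_mono power_le_one) auto
      then show ?thesis using True e x by (simp add: norm_mult norm_power add_increasing2)
    next
      case False
      then have "norm (f n) * x ^ n \<le> e / 2 * x ^ n"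
        using N[of n] x by (intro mult_right_mono) auto
      then show ?thesis using False e x by (simp add: norm_mult norm_power)
    qed
    have sf: "summable (\<lambda>n. f n * of_real x ^ n)"
      by (rule summable_comparison_test'[OF sums_summable[OF s3] le])
    have sg: "(\<lambda>n. L * of_real x ^ n) sums (L * (1 / (1 - of_real x)))"
      using x by (intro sums_mult geometric_sums) auto
    have "(\<Sum>n. d n * of_real x ^ n) = (\<Sum>n. f n * of_real x ^ n + L * of_real x ^ n)"
      by (simp add: f_def algebra_simps)
    also have "\<dots> = (\<Sum>n. f n * of_real x ^ n) + L * (1 / (1 - of_real x))"
      by (rule sums_unique[symmetric, OF sums_add[OF summable_sums[OF sf] sg]])
    finally have "(\<Sum>n. d n * of_real x ^ n) = (\<Sum>n. f n * of_real x ^ n) + L * (1 / (1 - of_real x))" .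
    note split = this
    have "(1 - x) *\<^sub>R (\<Sum>n. d n * of_real x ^ n) - L = (1 - x) *\<^sub>R (\<Sum>n. f n * of_real x ^ n)"
    proof -
      have "1 - complex_of_real x \<noteq> 0"
        using x by (metis eq_iff_diff_eq_0 less_irrefl of_real_eq_1_iff)
      then have "(1 - complex_of_real x) * (S + L * (1 / (1 - of_real x))) - L = (1 - complex_of_real x) * S" for S
        by (simp add: distrib_left)
      then show ?thesis
        by (simp only: split  scaleR_conv_of_real of_real_diff of_real_1)
    qed
    moreover have "norm (\<Sum>n. f n * of_real x ^ n) \<le> E + e / 2 * (1 / (1 - x))"
      using norm_suminf_le[OF le sums_summable[OF s3]] unfolding sums_unique[OF s3, symmetric] .
    ultimately have "norm ((1 - x) *\<^sub>R (\<Sum>n. d n * of_real x ^ n) - L) \<le> (1 - x) * (E + e / 2 * (1 / (1 - x)))"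
      using x by (simp add: mult_left_mono del: distrib_left)
    also have "\<dots> = (1 - x) * E + e / 2" using x by (simp add: field_simps)
    finally show ?thesis .
  qed
  have "((\<lambda>x. (1 - x) * E + e / 2) \<longlongrightarrow> (1 - 1) * E + e / 2) (at_left 1)"
    by (intro tendsto_intros)
  then have "\<forall>\<^sub>F x in at_left 1. (1 - x) * E + e / 2 < e"
    by (rule order_tendstoD(2)) (use e in auto)
  moreover have "\<forall>\<^sub>F x::real in at_left 1. 0 < x \<and> x < 1"
    using eventually_at_left_real[of 0 1] by simp
  ultimately show "\<forall>\<^sub>F x in at_left 1. dist ((1 - x) *\<^sub>R (\<Sum>n. d n * of_real x ^ n)) L < e"
  proof eventually_elim
    case (elim x)
    then show ?case using bound[of x] by (simp add: dist_norm)
  qed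
qed

text \<open>The operator \<theta> = z d/dz multiplies the coefficient of index n by n. Hence the
  recurrence for the coefficients sums to \<theta> F' + (a+b) F' = \<theta>^2 F + (a+b) \<theta> F +
  ab F, which is the differential equation. The last clause is the source of the logarithmic pole:
  F' behaves like a constant over 1 - x.\<close>

lemma hyp2F1_derivatives:
  assumes "a + b \<notin> \<int>\<^sub>\<le>\<^sub>0"
  obtains F1 F2 where
    "\<And>z. norm z < 1 \<Longrightarrow> (hyp2F1 a b (a + b) has_field_derivative F1 z) (at z)"
    "\<And>z. norm z < 1 \<Longrightarrow> (F1 has_field_derivative F2 z) (at z)"
    "continuous_on (ball 0 1) F2"
    "\<And>z. norm z < 1 \<Longrightarrow> z * (1 - z) * F2 z + (a + b - (a + b + 1) * z) * F1 z = a * b * hyp2F1 a b (a + b) z"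
    "((\<lambda>x::real. (1 - x) *\<^sub>R F1 (of_real x)) \<longlongrightarrow> rGamma a * rGamma b / rGamma (a + b)) (at_left 1)"
proof -
  let ?h = "hyp_coeff a b (a + b)"
  define F1 where "F1 z = (\<Sum>n. diffs ?h n * z ^ n)" for z
  define F2 where "F2 z = (\<Sum>n. diffs (diffs ?h) n * z ^ n)" for z
  \<comment> \<open>The third derivative serves only to make \<open>F2\<close> continuous.\<close>
  define F3 where "F3 z = (\<Sum>n. diffs (diffs (diffs ?h)) n * z ^ n)" for z
  have sm0: "summable (\<lambda>n. ?h n * z ^ n)" if "norm z < 1" for z
    by (rule summable_hyp_coeff[OF assms that])
  have step: "summable (\<lambda>n. diffs f n * z ^ n)"
    if "\<And>z. norm z < 1 \<Longrightarrow> summable (\<lambda>n. f n * z ^ n)" "norm z < 1" for f :: "nat \<Rightarrow> complex" and z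
    using that by (intro termdiff_converges[where K=1]) auto
  have sm1: "summable (\<lambda>n. diffs ?h n * z ^ n)" if "norm z < 1" for z
    by (rule step[OF sm0 that])
  have sm2: "summable (\<lambda>n. diffs (diffs ?h) n * z ^ n)" if "norm z < 1" for z
    by (rule step[OF sm1 that])
  have d0: "(hyp2F1 a b (a + b) has_field_derivative F1 z) (at z)" if "norm z < 1" for z
    unfolding hyp2F1_eq F1_def by (rule termdiffs_strong'[OF sm0 that])
  have d1: "(F1 has_field_derivative F2 z) (at z)" if "norm z < 1" for z
    unfolding F1_def[abs_def] F2_def by (rule termdiffs_strong'[OF sm1 that])
  have d2: "(F2 has_field_derivative F3 z) (at z)" if "norm z < 1" for z
    unfolding F2_def[abs_def] F3_def by (rule termdiffs_strong'[OF sm2 that])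
  have c2: "continuous_on (ball 0 1) F2"
    using d2 by (intro continuous_at_imp_continuous_on ballI DERIV_isCont[OF d2]) simp
  have euler: "(\<lambda>n. of_nat n * f n * z ^ n) sums (z * (\<Sum>n. diffs f n * z ^ n))"
    if "summable (\<lambda>n. diffs f n * z ^ n)" for f :: "nat \<Rightarrow> complex" and z
  proof -
    have "(\<lambda>n. z * (of_nat n * f n * z ^ (n - Suc 0))) sums (z * (\<Sum>n. diffs f n * z ^ n))"
      by (intro sums_mult diffs_equiv that)
    also have "(\<lambda>n. z * (of_nat n * f n * z ^ (n - Suc 0))) = (\<lambda>n. of_nat n * f n * z ^ n)"
    proof
      show "z * (of_nat n * f n * z ^ (n - Suc 0)) = of_nat n * f n * z ^ n" for n
        by (cases n) auto
    qed
    finally show ?thesis .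
  qed
  have ode: "z * (1 - z) * F2 z + (a + b - (a + b + 1) * z) * F1 z = a * b * hyp2F1 a b (a + b) z"
    if z: "norm z < 1" for z
  proof -
    have e1: "(\<lambda>n. of_nat n * ?h n * z ^ n) sums (z * F1 z)"
      unfolding F1_def by (rule euler[OF sm1[OF z]])
    have e2: "(\<lambda>n. of_nat n * diffs ?h n * z ^ n) sums (z * F2 z)"
      unfolding F2_def by (rule euler[OF sm2[OF z]])
    have s0: "(\<lambda>n. ?h n * z ^ n) sums hyp2F1 a b (a + b) z"
      unfolding hyp2F1_eq by (rule summable_sums[OF sm0[OF z]])
    have s1: "(\<lambda>n. diffs ?h n * z ^ n) sums F1 z"
      unfolding F1_def by (rule summable_sums[OF sm1[OF z]])
    have "(\<lambda>n. of_nat n * (of_nat n * ?h n) * z ^ n) sums (z * (F1 z + z * F2 z))"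
    proof -
      have df: "diffs (\<lambda>n. of_nat n * ?h n) = (\<lambda>n. diffs ?h n + of_nat n * diffs ?h n)"
        by (auto simp: diffs_def algebra_simps fun_eq_iff)
      have "(\<lambda>n. diffs (\<lambda>n. of_nat n * ?h n) n * z ^ n) sums (F1 z + z * F2 z)"
        unfolding df distrib_right by (rule sums_add[OF s1 e2])
      with euler[OF sums_summable[OF this]] sums_unique[OF this] show ?thesis by simp
    qed
    note e3 = this
    have "(\<lambda>n. of_nat n * diffs ?h n * z ^ n + (a + b) * (diffs ?h n * z ^ n))
       sums (z * F2 z + (a + b) * F1 z)"
      by (intro sums_add sums_mult e2 s1)
    moreover have "(\<lambda>n. of_nat n * (of_nat n * ?h n) * z ^ n + (a + b) * (of_nat n * ?h n * z ^ n) + a * b * (?h n * z ^ n))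
       sums (z * (F1 z + z * F2 z) + (a + b) * (z * F1 z) + a * b * hyp2F1 a b (a + b) z)"
      by (intro sums_add sums_mult e1 e3 s0)
    moreover have "(\<lambda>n. of_nat n * diffs ?h n * z ^ n + (a + b) * (diffs ?h n * z ^ n))
      = (\<lambda>n. of_nat n * (of_nat n * ?h n) * z ^ n + (a + b) * (of_nat n * ?h n * z ^ n) + a * b * (?h n * z ^ n))"
    proof
      fix n
      have "((a + b) + of_nat n) * diffs ?h n * z ^ n = (a + of_nat n) * (b + of_nat n) * ?h n * z ^ n"
        using hyp_coeff_Suc[OF assms, of n a b] by simp
      then show "of_nat n * diffs ?h n * z ^ n + (a + b) * (diffs ?h n * z ^ n)
        = of_nat n * (of_nat n * ?h n) * z ^ n + (a + b) * (of_nat n * ?h n * z ^ n) + a * b * (?h n * z ^ n)"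
        by (simp add: algebra_simps)
    qed
    ultimately have "z * F2 z + (a + b) * F1 z
       = z * (F1 z + z * F2 z) + (a + b) * (z * F1 z) + a * b * hyp2F1 a b (a + b) z"
      using sums_unique2 by fastforce
    then show ?thesis by (simp add: algebra_simps)
  qed
  have lim: "((\<lambda>x::real. (1 - x) *\<^sub>R F1 (of_real x)) \<longlongrightarrow> rGamma a * rGamma b / rGamma (a + b)) (at_left 1)"
    unfolding F1_def by (rule abel_tendsto_at_left[OF diffs_hyp_coeff_tendsto[OF assms]])
  show thesis
  proof (rule that)
    show "continuous_on (ball 0 1) F2" by (rule c2)
  qed (fact d0 d1 ode lim)+
qed

subsection \<open>The radial profile of the Green function\<close>

text \<open>A derivative bounded by C/t allows at most logarithmic growth, which the square root
  absorbs. At t = |w|^2 the square root is |w|, the weight in which the Green function is estimated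
  near the origin.\<close>

lemma sqrt_scaled_tendsto_0:
  fixes g g1 :: "real \<Rightarrow> 'a::real_normed_vector"
  assumes der: "\<And>t. 0 < t \<Longrightarrow> t < 1 \<Longrightarrow> (g has_vector_derivative g1 t) (at t)"
    and lim: "((\<lambda>t. t *\<^sub>R g1 t) \<longlongrightarrow> L) (at_right 0)"
  shows "((\<lambda>t. sqrt t *\<^sub>R g t) \<longlongrightarrow> 0) (at_right 0)"
proof -
  define C where "C = norm L + 1"
  have C: "C > 0" by (simp add: C_def add_nonneg_pos)
  have "\<forall>\<^sub>F t in at_right 0. norm (t *\<^sub>R g1 t) < C"
    using tendsto_norm[OF lim] by (rule order_tendstoD) (simp add: C_def)
  then obtain b where b: "b > 0" "\<And>t. 0 < t \<Longrightarrow> t < b \<Longrightarrow> norm (t *\<^sub>R g1 t) < C"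
    unfolding eventually_at_right_field by blast
  define r where "r = min b 1 / 2"
  have r: "0 < r" "r < 1" "r < b" using b(1) by (auto simp: r_def)
  have bound: "norm (g t) \<le> norm (g r) + C * (ln r - ln t)" if t: "0 < t" "t < r" for t
  proof -
    have "norm (g r - g t) \<le> C * ln r - C * ln t"
    proof (rule differentiable_bound_general[where f'=g1 and \<phi>'="\<lambda>u. C * (1 / u)"])
      show "continuous_on {t..r} g"
        using t r by (intro continuous_at_imp_continuous_on ballI has_vector_derivative_continuous[OF der]) auto
      show "continuous_on {t..r} (\<lambda>u. C * ln u)"
        using t by (auto intro!: continuous_intros)
      fix u assume u: "t < u" "u < r"
      show "(g has_vector_derivative g1 u) (at u)" using der u t r by auto
      show "((\<lambda>u. C * ln u) has_vector_derivative C * (1 / u)) (at u)"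
        using u t by (auto intro!: derivative_eq_intros simp flip: has_real_derivative_iff_has_vector_derivative)
      have "u * norm (g1 u) \<le> C" using b(2)[of u] u t r by simp
      then show "norm (g1 u) \<le> C * (1 / u)" using u t by (simp add: field_simps)
    qed (use t in auto)
    moreover have "norm (g t) \<le> norm (g r) + norm (g r - g t)"
      by (metis norm_minus_commute norm_triangle_sub)
    ultimately show ?thesis by (simp add: algebra_simps)
  qed
  have "((\<lambda>t. sqrt t * (norm (g r) + C * (ln r - ln t))) \<longlongrightarrow> 0) (at_right 0)"
    using C by real_asymp
  then show ?thesis
  proof (rule Lim_null_comparison[rotated])
    show "\<forall>\<^sub>F t in at_right 0. norm (sqrt t *\<^sub>R g t) \<le> sqrt t * (norm (g r) + C * (ln r - ln t))"
      using eventually_at_right_real[OF r(1)]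
    proof eventually_elim
      case (elim t)
      then show ?case using bound[of t] by (simp add: mult_left_mono)
    qed
  qed
qed

text \<open>In the variable \<open>t = |w|\<^sup>2\<close> the Laplacian of a radial function is \<open>4 (g' + t g'')\<close>.\<close>
lemma Gk_radial_profile:
  assumes "s - of_real \<bar>k\<bar> \<notin> \<int>\<^sub>\<le>\<^sub>0" "s + of_real \<bar>k\<bar> \<notin> \<int>\<^sub>\<le>\<^sub>0" "2 * s \<notin> \<int>\<^sub>\<le>\<^sub>0"
  obtains g g1 g2 :: "real \<Rightarrow> complex" where
    "\<And>w. w \<in> ball 0 1 \<Longrightarrow> Gk k s w = g ((cmod w)\<^sup>2)"
    "\<And>t. 0 < t \<Longrightarrow> t < 1 \<Longrightarrow> (g has_vector_derivative g1 t) (at t)"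
    "\<And>t. 0 < t \<Longrightarrow> t < 1 \<Longrightarrow> (g1 has_vector_derivative g2 t) (at t)"
    "continuous_on {0<..<1} g2"
    "\<And>t. 0 < t \<Longrightarrow> t < 1 \<Longrightarrow>
      g1 t + of_real t * g2 t = - (of_real (k\<^sup>2 * (1 - t)) + s * (1 - s)) / of_real ((1 - t)\<^sup>2) * g t"
    "((\<lambda>t. t *\<^sub>R g1 t) \<longlongrightarrow> - 1 / (4 * of_real pi)) (at_right 0)"
proof -
  define a where "a = s - of_real \<bar>k\<bar>"
  define b where "b = s + of_real \<bar>k\<bar>"
  have ab: "a + b = 2 * s" by (simp add: a_def b_def)
  have "complex_of_real \<bar>k\<bar> * of_real \<bar>k\<bar> = (of_real k)\<^sup>2"
    by (simp add: power2_eq_square flip: of_real_mult)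
  then have prod: "a * b = s * s - (of_real k)\<^sup>2"
    by (simp add: a_def b_def algebra_simps power2_eq_square)
  have nz: "Gamma a \<noteq> 0" "Gamma b \<noteq> 0" "Gamma (2 * s) \<noteq> 0"
    using assms by (simp_all add: a_def b_def Gamma_eq_zero_iff)
  have nab: "a + b \<notin> \<int>\<^sub>\<le>\<^sub>0" using assms(3) ab by simp
  obtain F1 F2 where F:
    "\<And>z. norm z < 1 \<Longrightarrow> (hyp2F1 a b (a + b) has_field_derivative F1 z) (at z)"
    "\<And>z. norm z < 1 \<Longrightarrow> (F1 has_field_derivative F2 z) (at z)"
    "continuous_on (ball 0 1) F2"
    "\<And>z. norm z < 1 \<Longrightarrow> z * (1 - z) * F2 z + (a + b - (a + b + 1) * z) * F1 z = a * b * hyp2F1 a b (a + b) z"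
    "((\<lambda>x::real. (1 - x) *\<^sub>R F1 (of_real x)) \<longlongrightarrow> rGamma a * rGamma b / rGamma (a + b)) (at_left 1)"
    using hyp2F1_derivatives[OF nab] by blast
  define F0 where "F0 = hyp2F1 a b (a + b)"
  define K where "K = Gamma a * Gamma b / (4 * of_real pi * Gamma (2 * s))"
  define G where "G z = K * (z powr s * F0 z)" for z
  define G1 where "G1 z = K * (s * z powr (s - 1) * F0 z + z powr s * F1 z)" for z
  define G2 where "G2 z = K * (s * ((s - 1) * z powr (s - 2)) * F0 z + 2 * s * z powr (s - 1) * F1 z + z powr s * F2 z)" for z
  have dG: "(G has_field_derivative G1 (of_real x)) (at (of_real x))" 
    and dG1: "(G1 has_field_derivative G2 (of_real x)) (at (of_real x))" if "0 < x" "x < 1" for x :: real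
  proof -
    have x: "norm (complex_of_real x) < 1" "complex_of_real x \<notin> \<real>\<^sub>\<le>\<^sub>0"
      using that by (auto simp: complex_nonpos_Reals_iff)
    show "(G has_field_derivative G1 (of_real x)) (at (of_real x))"
      unfolding G_def[abs_def] G1_def F0_def
      by (rule derivative_eq_intros F(1) x refl | simp add: algebra_simps)+
    show "(G1 has_field_derivative G2 (of_real x)) (at (of_real x))"
      unfolding G1_def[abs_def] G2_def F0_def
      by (rule derivative_eq_intros F(1,2) x refl | simp add: algebra_simps)+
  qed
  define g where "g t = G (of_real (1 - t))" for t
  define g1 where "g1 t = - G1 (of_real (1 - t))" for t
  define g2 where "g2 t = G2 (of_real (1 - t))" for t
  have chain: "((\<lambda>t. f (of_real (1 - t))) has_vector_derivative - f') (at t)"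
    if "(f has_field_derivative f') (at (of_real (1 - t)))" for f :: "complex \<Rightarrow> complex" and f' and t :: real
  proof -
    have "((\<lambda>t. complex_of_real (1 - t)) has_vector_derivative -1) (at t)"
      by (auto intro!: derivative_eq_intros)
    from field_vector_diff_chain_at[OF this that] show ?thesis by (simp add: o_def)
  qed
  have eG: "Gk k s w = g ((cmod w)\<^sup>2)" if "w \<in> ball 0 1" for w
  proof -
    define x where "x = 1 - (cmod w)\<^sup>2"
    have x: "x > 0" using that by (simp add: x_def power_less_one_iff abs_square_less_1)
    \<comment> \<open>Since \<open>x\<close> is a positive real, the principal logarithm of its
      reciprocal is real and just changes sign; no branch correction arises.\<close>
    have "complex_of_real (1 / x) powr (- s) = of_real x powr s"
    proof -
      have "Ln (complex_of_real (1 / x)) = - of_real (ln x)"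
        using Ln_of_real[of "1 / x"] x by (simp add: ln_div del: of_real_divide)
      then show ?thesis
        using x by (simp add: powr_def Ln_of_real del: of_real_divide)
    qed
    then show ?thesis
      unfolding Gk_def Let_def x_def[symmetric] g_def G_def K_def F0_def a_def[symmetric] b_def[symmetric] ab
      by simp
  qed
  have dg: "(g has_vector_derivative g1 t) (at t)" if "0 < t" "t < 1" for t
    unfolding g_def[abs_def] g1_def by (rule chain, rule dG) (use that in auto)
  have dg1: "(g1 has_vector_derivative g2 t) (at t)" if "0 < t" "t < 1" for t
  proof -
    have "((\<lambda>t. G1 (of_real (1 - t))) has_vector_derivative - G2 (of_real (1 - t))) (at t)"
      by (rule chain, rule dG1) (use that in auto)
    from has_vector_derivative_minus[OF this] show ?thesis
      by (simp add: g1_def[abs_def] g2_def)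
  qed
  have c0: "continuous_on (ball 0 1) F0" "continuous_on (ball 0 1) F1"
    unfolding F0_def
    by (intro continuous_at_imp_continuous_on ballI DERIV_isCont[OF F(1)] DERIV_isCont[OF F(2)]; simp)+
  have cg2: "continuous_on {0<..<1} g2"
  proof -
    have sub: "(\<lambda>t. complex_of_real (1 - t)) ` {0<..<1} \<subseteq> ball 0 1"
      by (auto simp del: of_real_diff)
    have cF: "continuous_on {0<..<1} (\<lambda>t. f (complex_of_real (1 - t)))" if "continuous_on (ball 0 1) f" for f :: "complex \<Rightarrow> complex"
      by (rule continuous_on_compose2[OF that _ sub]) (intro continuous_intros)
    show ?thesis
      unfolding g2_def G2_def
      by (intro continuous_intros cF c0 F(3)) (auto simp: complex_nonpos_Reals_iff)
  qed
  have ode: "g1 t + of_real t * g2 t = - (of_real (k\<^sup>2 * (1 - t)) + s * (1 - s)) / of_real ((1 - t)\<^sup>2) * g t"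
    if t: "0 < t" "t < 1" for t
  proof -
    define z where "z = complex_of_real (1 - t)"
    define p where "p = z powr s"
    have z: "z \<noteq> 0" "norm z < 1" "of_real t = 1 - z"
      using t by (auto simp: z_def simp del: of_real_diff) simp
    have pw: "z powr (s - 1) = p / z" "z powr (s - 2) = p / z\<^sup>2"
      using z(1) by (simp_all add: powr_diff p_def)
    have o: "z * (1 - z) * F2 z = a * b * F0 z - (2 * s - (2 * s + 1) * z) * F1 z"
      using F(4)[OF z(2)] unfolding ab F0_def by (simp add: algebra_simps)
    \<comment> \<open>After multiplication by z^2 the second derivative of F occurs only in the
      combination z (1 - z) F'', which the hypergeometric equation eliminates. Then the terms with
      F' cancel, and a b = s^2 - k^2 gives the coefficient of F.\<close>
    have "z\<^sup>2 * (g1 t + of_real t * g2 t) =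
       K * p * (- s * z * F0 z - z\<^sup>2 * F1 z + (1 - z) * (s * (s - 1) * F0 z + 2 * s * z * F1 z) + z * (z * (1 - z) * F2 z))"
      unfolding g1_def g2_def G1_def G2_def z_def[symmetric] pw z(3) p_def[symmetric]
      using z(1) by (simp add: field_simps power2_eq_square)
    also have "\<dots> = - (of_real k ^ 2 * z + s * (1 - s)) * (K * (p * F0 z))"
      unfolding o prod by (simp add: algebra_simps power2_eq_square)
    finally have "g1 t + of_real t * g2 t = - (of_real k ^ 2 * z + s * (1 - s)) * (K * (p * F0 z)) / z\<^sup>2"
      using z(1) by (simp add: field_simps)
    then show ?thesis
      unfolding g_def G_def z_def[symmetric] p_def[symmetric] of_real_mult of_real_power by simp
  qed
  have limF1: "((\<lambda>t. t *\<^sub>R F1 (of_real (1 - t))) \<longlongrightarrow> rGamma a * rGamma b / rGamma (a + b)) (at_right 0)"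
  proof -
    have "filterlim (\<lambda>t::real. 1 - t) (at_left 1) (at_right 0)"
      by real_asymp
    from filterlim_compose[OF F(5) this] show ?thesis by simp
  qed
  \<comment> \<open>Differentiating the factor z^s leaves a term containing F itself. It may grow
    logarithmically, but the factor t removes it, so that only F' contributes to the limit.\<close>
  have limF0: "((\<lambda>t. t *\<^sub>R F0 (of_real (1 - t))) \<longlongrightarrow> 0) (at_right 0)"
  proof -
    have d: "((\<lambda>t. F0 (of_real (1 - t))) has_vector_derivative - F1 (of_real (1 - t))) (at t)"
      if "0 < t" "t < 1" for t
      unfolding F0_def by (rule chain, rule F(1)) (use that in \<open>auto simp del: of_real_diff\<close>)
    have "((\<lambda>t. sqrt t *\<^sub>R F0 (of_real (1 - t))) \<longlongrightarrow> 0) (at_right 0)"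
      by (rule sqrt_scaled_tendsto_0[OF d]) (use tendsto_minus[OF limF1] in auto)
    moreover have "((\<lambda>t. sqrt t) \<longlongrightarrow> 0) (at_right 0)" by real_asymp
    ultimately have "((\<lambda>t. sqrt t *\<^sub>R (sqrt t *\<^sub>R F0 (of_real (1 - t)))) \<longlongrightarrow> 0 *\<^sub>R 0) (at_right 0)"
      by (intro tendsto_intros)
    then have "((\<lambda>t. sqrt t *\<^sub>R (sqrt t *\<^sub>R F0 (of_real (1 - t)))) \<longlongrightarrow> 0) (at_right 0)" by simp
    then show ?thesis
      by (rule Lim_transform_eventually)
        (use eventually_at_right_less[of "0::real"] in \<open>auto elim!: eventually_mono\<close>)
  qed
  have powlim: "((\<lambda>t::real. complex_of_real (1 - t) powr c) \<longlongrightarrow> 1) (at_right 0)" for c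
  proof -
    have "((\<lambda>t::real. complex_of_real (1 - t) powr c) \<longlongrightarrow> complex_of_real (1 - 0) powr c) (at_right 0)"
      by (intro tendsto_intros) auto
    then show ?thesis by simp
  qed
  have "((\<lambda>t. - (K * (s * of_real (1 - t) powr (s - 1) * (t *\<^sub>R F0 (of_real (1 - t)))
      + of_real (1 - t) powr s * (t *\<^sub>R F1 (of_real (1 - t))))))
     \<longlongrightarrow> - (K * (s * 1 * 0 + 1 * (rGamma a * rGamma b / rGamma (a + b))))) (at_right 0)"
    by (intro tendsto_intros limF0 limF1 powlim)
  \<comment> \<open>The Gamma factors in the normalisation of the Green function are the reciprocals
    of those in the Abel limit; 1/(4 pi) remains.\<close>
  moreover have "- (K * (s * 1 * 0 + 1 * (rGamma a * rGamma b / rGamma (a + b)))) = - 1 / (4 * of_real pi)"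
    using nz unfolding ab K_def by (simp add: rGamma_inverse_Gamma field_simps)
  ultimately have lim: "((\<lambda>t. t *\<^sub>R g1 t) \<longlongrightarrow> - 1 / (4 * of_real pi)) (at_right 0)"
    unfolding g1_def G1_def by (simp add: scaleR_conv_of_real algebra_simps)
  show thesis
    by (rule that) (fact eG dg dg1 cg2 ode lim)+
qed

subsection \<open>Test functions and the cut-off Green identity\<close>

text \<open>The integration by parts wants coefficients that are differentiable for all t < 1,
  including t \<le> 0, while the profile lives on 0 < t < 1. A factor that is zero up to e > 0 hides
  the singular end: below e the product is locally zero, from e on the product rule applies.\<close>

lemma has_vector_derivative_vanishing_mult:
  fixes c c' :: "real \<Rightarrow> real" and h h' :: "real \<Rightarrow> complex"
  assumes c: "\<And>t. (c has_real_derivative c' t) (at t)" and h: "\<And>t. 0 < t \<Longrightarrow> t < 1 \<Longrightarrow> (h has_vector_derivative h' t) (at t)"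
    and zero: "0 < e" "\<And>t. t \<le> e \<Longrightarrow> c t = 0" "\<And>t. t \<le> e \<Longrightarrow> c' t = 0" and t: "t < 1"
  shows "((\<lambda>t. of_real (c t) * h t) has_vector_derivative of_real (c' t) * h t + of_real (c t) * h' t) (at t)"
proof (cases "t < e")
  case True
  then have ev: "\<forall>\<^sub>F u in at t. u < e"
    by (rule order_tendstoD(2)[OF tendsto_ident_at])
  have "((\<lambda>t. 0 :: complex) has_vector_derivative 0) (at t)" by simp
  then have "((\<lambda>t. of_real (c t) * h t) has_vector_derivative 0) (at t)"
    unfolding has_vector_derivative_def
    by (rule has_derivative_transform_eventually)
      (use ev True zero in \<open>auto elim!: eventually_mono\<close>)
  then show ?thesis using True zero by simp
next
  case False
  have "((\<lambda>t. complex_of_real (c t)) has_vector_derivative of_real (c' t)) (at t)"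
    by (intro has_vector_derivative_of_real c)
  from has_vector_derivative_mult[OF this h[of t]] show ?thesis
    using False t zero(1) by (simp add: add.commute)
qed

lemma continuous_on_vanishing_mult:
  fixes c :: "real \<Rightarrow> real" and h :: "real \<Rightarrow> complex"
  assumes c: "continuous_on UNIV c" and h: "continuous_on {0<..<1} h"
    and zero: "0 < e" "\<And>t. t \<le> e \<Longrightarrow> c t = 0"
  shows "continuous_on {..<1} (\<lambda>t. of_real (c t) * h t)"
proof -
  have "continuous_on {..<min e 1} (\<lambda>t. of_real (c t) * h t)"
    using zero by (auto intro!: continuous_on_eq[OF continuous_on_const[of _ 0]])
  moreover have "continuous_on {0<..<1} (\<lambda>t. of_real (c t) * h t)"
    by (intro continuous_intros h continuous_on_subset[OF c]) auto
  ultimately have "continuous_on ({..<min e 1} \<union> {0<..<1}) (\<lambda>t. of_real (c t) * h t)"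
    by (intro continuous_on_open_Un) auto
  moreover have "{..<min e 1} \<union> {0<..<1} = {..<1}" using zero(1) by auto
  ultimately show ?thesis by simp
qed

lemma pd_has_vector_derivative:
  assumes "f differentiable (at w)"
  shows "((\<lambda>t. f (w + of_real t * d)) has_vector_derivative pd d f w) (at 0)"
proof -
  have "(\<lambda>t. w + complex_of_real t * d) differentiable (at 0)"
    by (intro derivative_intros differentiableI) (auto intro!: derivative_eq_intros)
  moreover have "f differentiable (at (w + complex_of_real 0 * d))" using assms by simp
  ultimately have "(f \<circ> (\<lambda>t. w + complex_of_real t * d)) differentiable (at 0)"
    by (rule differentiable_chain_at)
  then show ?thesis
    unfolding pd_def by (simp add: vector_derivative_works o_def)
qed

lemma pd_eqI:
  assumes "((\<lambda>t. f (w + of_real t * d)) has_vector_derivative f') (at 0)"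
  shows "pd d f w = f'"
  unfolding pd_def using assms by (rule vector_derivative_at)

lemma pd_eq_0:
  assumes "open S" "w \<in> S" "\<And>z. z \<in> S \<Longrightarrow> f z = 0"
  shows "pd d f w = 0"
proof (rule pd_eqI)
  have "((\<lambda>t. w + of_real t * d) \<longlongrightarrow> w + of_real 0 * d) (at 0)" by (intro tendsto_intros)
  then have ev: "\<forall>\<^sub>F t in at (0::real). w + of_real t * d \<in> S"
    by (rule topological_tendstoD) (use assms in auto)
  have "((\<lambda>t. 0 :: complex) has_vector_derivative 0) (at (0::real))" by simp
  then show "((\<lambda>t. f (w + of_real t * d)) has_vector_derivative 0) (at 0)"
    unfolding has_vector_derivative_def
    by (rule has_derivative_transform_eventually)
      (use ev assms in \<open>auto elim!: eventually_mono\<close>)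
qed

lemma test_fun_support:
  assumes "test_fun \<phi>"
  obtains R where "0 < R" "R < 1" "\<And>ds w. R \<le> cmod w \<Longrightarrow> iter_pd ds \<phi> w = 0"
proof -
  let ?K = "closure {w. \<phi> w \<noteq> 0}"
  have K: "compact ?K" "?K \<subseteq> ball 0 1" using assms by (auto simp: test_fun_def)
  have "\<exists>M<1. 0 \<le> M \<and> (\<forall>w\<in>?K. cmod w \<le> M)"
  proof (cases "?K = {}")
    case False
    obtain w0 where "w0 \<in> ?K" "\<forall>w\<in>?K. cmod w \<le> cmod w0"
      using continuous_attains_sup[OF K(1) False, of cmod] continuous_on_norm_id by blast
    then show ?thesis using K(2) by (intro exI[of _ "cmod w0"]) auto
  qed (intro exI[of _ 0], auto)
  then obtain M where M: "M < 1" "0 \<le> M" "\<And>w. w \<in> ?K \<Longrightarrow> cmod w \<le> M" by blast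
  have "iter_pd ds \<phi> w = 0" if "w \<in> - cball 0 M" for ds w
    using that
  proof (induction ds arbitrary: w)
    case Nil
    then have "w \<notin> ?K" using M(3)[of w] by auto
    then show ?case using closure_subset[of "{w. \<phi> w \<noteq> 0}"] by auto
  next
    case (Cons d ds)
    then show ?case by (auto intro!: pd_eq_0[of "- cball 0 M"])
  qed
  \<comment> \<open>A radius strictly between M and 1: every point at distance at least R then lies
    in the open set \<open>- cball 0 M\<close>, where all derivatives vanish.\<close>
  then show thesis using M by (intro that[of "(M + 1) / 2"]) auto
qed

lemma test_fun_smooth:
  assumes "test_fun \<phi>" "set ds \<subseteq> {1, \<i>}"
  shows "iter_pd ds \<phi> differentiable (at w)" "continuous_on UNIV (iter_pd ds \<phi>)"
proof -
  have d: "iter_pd ds \<phi> differentiable_on UNIV"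
    using assms by (simp add: test_fun_def smooth_fun_def)
  then show "iter_pd ds \<phi> differentiable (at w)" by (simp add: differentiable_on_def)
  show "continuous_on UNIV (iter_pd ds \<phi>)" using d by (rule differentiable_imp_continuous_on)
qed

lemma test_fun_derivative:
  assumes "test_fun \<phi>"
  shows "((\<lambda>t. \<phi> (w + of_real t * d)) has_vector_derivative pd d \<phi> w) (at 0)"
    and "d' \<in> {1, \<i>} \<Longrightarrow>
      ((\<lambda>t. pd d' \<phi> (w + of_real t * d)) has_vector_derivative pd d (pd d' \<phi>) w) (at 0)"
  using test_fun_smooth(1)[OF assms, of "[]"] test_fun_smooth(1)[OF assms, of "[d']"]
  by (simp_all add: pd_has_vector_derivative)

lemma test_fun_continuous_on:
  assumes "test_fun \<phi>" "{d, d'} \<subseteq> {1, \<i>}"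
  shows "continuous_on UNIV (pd d \<phi>)" "continuous_on UNIV (pd d' (pd d \<phi>))" "continuous_on UNIV \<phi>"
  using test_fun_smooth(2)[OF assms(1), of "[d]"] test_fun_smooth(2)[OF assms(1), of "[d', d]"]
    test_fun_smooth(2)[OF assms(1), of "[]"] assms(2)
  by auto

lemma test_fun_pd_support:
  assumes "test_fun \<phi>"
  obtains R where "0 < R" "R < 1" "\<And>w. R \<le> cmod w \<Longrightarrow> \<phi> w = 0"
    "\<And>d w. R \<le> cmod w \<Longrightarrow> pd d \<phi> w = 0" "\<And>d d' w. R \<le> cmod w \<Longrightarrow> pd d' (pd d \<phi>) w = 0"
proof -
  obtain R where R: "0 < R" "R < 1" "\<And>ds w. R \<le> cmod w \<Longrightarrow> iter_pd ds \<phi> w = 0"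
    using test_fun_support[OF assms] by blast
  show thesis
  proof (rule that[OF R(1,2)])
    fix w d d' assume "R \<le> cmod w"
    then show "\<phi> w = 0" "pd d \<phi> w = 0" "pd d' (pd d \<phi>) w = 0"
      using R(3)[of w "[]"] R(3)[of w "[d]"] R(3)[of w "[d', d]"] by auto
  qed
qed

text \<open>Two integrations by parts replace the symmetry of the second derivatives.\<close>
lemma radial_mixed_partials:
  assumes A: "\<And>t. t < 1 \<Longrightarrow> (A has_vector_derivative A' t) (at t)"
      "\<And>t. t < 1 \<Longrightarrow> (A' has_vector_derivative A'' t) (at t)" "continuous_on {..<1} A''"
    and \<phi>: "test_fun \<phi>"
  shows "has_bochner_integral lborel
    (\<lambda>w. A ((cmod w)\<^sup>2) * (pd 1 (pd \<i> \<phi>) w - pd \<i> (pd 1 \<phi>) w)) 0"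
proof -
  obtain R where R: "0 < R" "R < 1" and supp: "\<And>w. R \<le> cmod w \<Longrightarrow> \<phi> w = 0"
      "\<And>d w. R \<le> cmod w \<Longrightarrow> pd d \<phi> w = 0" "\<And>d d' w. R \<le> cmod w \<Longrightarrow> pd d' (pd d \<phi>) w = 0"
    using test_fun_pd_support[OF \<phi>] by blast
  have cA': "continuous_on {..<1} A'"
    by (intro continuous_at_imp_continuous_on ballI has_vector_derivative_continuous[OF A(2)]) simp
  note dpd = test_fun_derivative(2)[OF \<phi>]
  \<comment> \<open>Moving along \<i> leaves the real part fixed, so the coordinate factor
    contributes no derivative of its own; likewise below for the imaginary part along 1.\<close>
  have dRe: "((\<lambda>t. complex_of_real (Re (w + of_real t * \<i>)) * \<phi> (w + of_real t * \<i>)) has_vector_derivative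
      of_real (Re w) * pd \<i> \<phi> w) (at 0)" for w
    using has_vector_derivative_mult[OF has_vector_derivative_const[of "complex_of_real (Re w)"] test_fun_derivative(1)[OF \<phi>, of w \<i>]] by simp
  have dIm: "((\<lambda>t. complex_of_real (Im (w + of_real t * 1)) * \<phi> (w + of_real t * 1)) has_vector_derivative
      of_real (Im w) * pd 1 \<phi> w) (at 0)" for w
    using has_vector_derivative_mult[OF has_vector_derivative_const[of "complex_of_real (Im w)"] test_fun_derivative(1)[OF \<phi>, of w 1]] by simp
  note cont = test_fun_continuous_on[OF \<phi>]
  have 1: "has_bochner_integral lborel (\<lambda>w. A ((cmod w)\<^sup>2) * pd 1 (pd \<i> \<phi>) w
      + 2 * of_real (w \<bullet> 1) * A' ((cmod w)\<^sup>2) * pd \<i> \<phi> w) 0"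
    by (rule radial_integration_by_parts[OF A(1) cA' dpd cont(1,2) R(2) supp(2,3)]) auto
  have 2: "has_bochner_integral lborel (\<lambda>w. A ((cmod w)\<^sup>2) * pd \<i> (pd 1 \<phi>) w
      + 2 * of_real (w \<bullet> \<i>) * A' ((cmod w)\<^sup>2) * pd 1 \<phi> w) 0"
    by (rule radial_integration_by_parts[OF A(1) cA' dpd cont(1,2) R(2) supp(2,3)]) auto
  have 3: "has_bochner_integral lborel (\<lambda>w. A' ((cmod w)\<^sup>2) * (of_real (Re w) * pd \<i> \<phi> w)
      + 2 * of_real (w \<bullet> \<i>) * A'' ((cmod w)\<^sup>2) * (of_real (Re w) * \<phi> w)) 0"
    by (intro radial_integration_by_parts[OF A(2,3) _ _ _ R(2)] dRe continuous_intros cont) (auto simp: supp)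
  have 4: "has_bochner_integral lborel (\<lambda>w. A' ((cmod w)\<^sup>2) * (of_real (Im w) * pd 1 \<phi> w)
      + 2 * of_real (w \<bullet> 1) * A'' ((cmod w)\<^sup>2) * (of_real (Im w) * \<phi> w)) 0"
    by (intro radial_integration_by_parts[OF A(2,3) _ _ _ R(2)] dIm continuous_intros cont) (auto simp: supp)
  \<comment> \<open>Write w = x + iy. The first round leaves 2 A' times the rotation derivative of
    \<open>\<phi>\<close>. The second round removes it, because its two remaining terms are both 2xy
    A'' \<open>\<phi>\<close> and cancel.\<close>
  from has_bochner_integral_add[OF has_bochner_integral_diff[OF 1 2]
      has_bochner_integral_mult_right[where c=2, OF has_bochner_integral_diff[OF 4 3]]]
  show ?thesis
    by (rule has_bochner_integral_cong[THEN iffD1, rotated -1])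
       (auto simp: inner_complex_def algebra_simps)
qed

text \<open>The divergence theorem for \<open>c (g \<nabla>\<phi> - \<phi> \<nabla>g + m \<phi> iw)\<close>, where \<open>c\<close>, \<open>g\<close>, \<open>m\<close> are functions of \<open>|w|\<^sup>2\<close>.\<close>
lemma cut_green_identity:
  fixes c c' c'' :: "real \<Rightarrow> real" and g g1 g2 m m1 :: "real \<Rightarrow> complex"
  assumes c: "\<And>t. (c has_real_derivative c' t) (at t)" "\<And>t. (c' has_real_derivative c'' t) (at t)"
      "continuous_on UNIV c''"
    and zero: "0 < e" "\<And>t. t \<le> e \<Longrightarrow> c t = 0" "\<And>t. t \<le> e \<Longrightarrow> c' t = 0" "\<And>t. t \<le> e \<Longrightarrow> c'' t = 0"
    and g: "\<And>t. 0 < t \<Longrightarrow> t < 1 \<Longrightarrow> (g has_vector_derivative g1 t) (at t)"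
      "\<And>t. 0 < t \<Longrightarrow> t < 1 \<Longrightarrow> (g1 has_vector_derivative g2 t) (at t)" "continuous_on {0<..<1} g2"
    and m: "\<And>t. 0 < t \<Longrightarrow> t < 1 \<Longrightarrow> (m has_vector_derivative m1 t) (at t)" "continuous_on {0<..<1} m1"
    and \<phi>: "test_fun \<phi>"
  shows "has_bochner_integral lborel (\<lambda>w. let t = (cmod w)\<^sup>2; x = of_real (Re w); y = of_real (Im w) in
      of_real (c t) * (g t * (pd 1 (pd 1 \<phi>) w + pd \<i> (pd \<i> \<phi>) w + \<i> * (pd 1 (pd \<i> \<phi>) w - pd \<i> (pd 1 \<phi>) w))
         + m t * (x * pd \<i> \<phi> w - y * pd 1 \<phi> w) - 4 * (g1 t + of_real t * g2 t) * \<phi> w)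
      + of_real (c' t) * (2 * g t * (x * pd 1 \<phi> w + y * pd \<i> \<phi> w) - 4 * of_real t * g1 t * \<phi> w)) 0"
proof -
  obtain R where R: "0 < R" "R < 1" and supp: "\<And>w. R \<le> cmod w \<Longrightarrow> \<phi> w = 0"
      "\<And>d w. R \<le> cmod w \<Longrightarrow> pd d \<phi> w = 0" "\<And>d d' w. R \<le> cmod w \<Longrightarrow> pd d' (pd d \<phi>) w = 0"
    using test_fun_pd_support[OF \<phi>] by blast
  note dpd = test_fun_derivative(2)[OF \<phi>]
  have dlin: "((\<lambda>t. L (w + of_real t * d) * \<phi> (w + of_real t * d)) has_vector_derivative
      L d * \<phi> w + L w * pd d \<phi> w) (at 0)" if "bounded_linear L" for L :: "complex \<Rightarrow> complex" and w d
  proof -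
    have "((\<lambda>t. w + t *\<^sub>R d) has_vector_derivative d) (at 0)"
      by (auto intro!: derivative_eq_intros)
    from bounded_linear.has_vector_derivative[OF that this]
    have "((\<lambda>t. L (w + of_real t * d)) has_vector_derivative L d) (at 0)"
      by (simp add: scaleR_conv_of_real)
    from has_vector_derivative_mult[OF this test_fun_derivative(1)[OF \<phi>, of w d]] show ?thesis by (simp add: add.commute)
  qed
  have bl: "bounded_linear (\<lambda>w. complex_of_real (Re w))" "bounded_linear (\<lambda>w. complex_of_real (Im w))"
    "bounded_linear (\<lambda>w. - complex_of_real (Im w))"
    by (intro bounded_linear_compose[OF bounded_linear_of_real] bounded_linear_minus bounded_linear_Re bounded_linear_Im)+
  note cont = test_fun_continuous_on[OF \<phi>]
  have cc: "continuous_on UNIV c" "continuous_on UNIV c'"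
    by (intro continuous_at_imp_continuous_on ballI DERIV_isCont[OF c(1)] DERIV_isCont[OF c(2)])+
  have cg: "continuous_on {0<..<1} g" "continuous_on {0<..<1} g1" "continuous_on {0<..<1} m"
    by (intro continuous_at_imp_continuous_on ballI has_vector_derivative_continuous[OF g(1)]
        has_vector_derivative_continuous[OF g(2)] has_vector_derivative_continuous[OF m(1)]; simp)+
  note vm = has_vector_derivative_vanishing_mult and cvm = continuous_on_vanishing_mult
  define A where "A t = of_real (c t) * g t" for t
  define A1 where "A1 t = of_real (c' t) * g t + of_real (c t) * g1 t" for t
  define A2 where "A2 t = (of_real (c'' t) * g t + of_real (c' t) * g1 t) + (of_real (c' t) * g1 t + of_real (c t) * g2 t)" for t
  define B where "B t = of_real (c t) * g1 t" for t
  define B1 where "B1 t = of_real (c' t) * g1 t + of_real (c t) * g2 t" for t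
  define C where "C t = of_real (c t) * m t" for t
  define C1 where "C1 t = of_real (c' t) * m t + of_real (c t) * m1 t" for t
  have dA: "(A has_vector_derivative A1 t) (at t)" if "t < 1" for t
    unfolding A_def[abs_def] A1_def by (rule vm[OF c(1) g(1) zero(1-3) that])
  have dA1: "(A1 has_vector_derivative A2 t) (at t)" if "t < 1" for t
    unfolding A1_def[abs_def] A2_def
    by (intro has_vector_derivative_add vm[OF c(2) g(1) zero(1,3,4) that] vm[OF c(1) g(2) zero(1-3) that])
  have cA1: "continuous_on {..<1} A1"
    unfolding A1_def by (intro continuous_on_add cvm[OF cc(1) _ zero(1,2)] cvm[OF cc(2) _ zero(1,3)] cg)
  have cA2: "continuous_on {..<1} A2"
    unfolding A2_def by (intro continuous_on_add cvm[OF cc(1) _ zero(1,2)] cvm[OF cc(2) _ zero(1,3)] cvm[OF c(3) _ zero(1,4)] cg g(3))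
  have dB: "(B has_vector_derivative B1 t) (at t)" if "t < 1" for t
    unfolding B_def[abs_def] B1_def by (rule vm[OF c(1) g(2) zero(1-3) that])
  have cB1: "continuous_on {..<1} B1"
    unfolding B1_def by (intro continuous_on_add cvm[OF cc(1) _ zero(1,2)] cvm[OF cc(2) _ zero(1,3)] cg g(3))
  have dC: "(C has_vector_derivative C1 t) (at t)" if "t < 1" for t
    unfolding C_def[abs_def] C1_def by (rule vm[OF c(1) m(1) zero(1-3) that])
  have cC1: "continuous_on {..<1} C1"
    unfolding C1_def by (intro continuous_on_add cvm[OF cc(1) _ zero(1,2)] cvm[OF cc(2) _ zero(1,3)] cg m(2))
  have 1: "has_bochner_integral lborel (\<lambda>w. A ((cmod w)\<^sup>2) * pd d (pd d \<phi>) w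
      + 2 * of_real (w \<bullet> d) * A1 ((cmod w)\<^sup>2) * pd d \<phi> w) 0" if "d \<in> {1, \<i>}" for d
    by (rule radial_integration_by_parts[OF dA cA1 dpd[OF that] cont(1,2) R(2) supp(2,3)]) (use that in auto)
  have lin: "has_bochner_integral lborel (\<lambda>w. H ((cmod w)\<^sup>2) * (L d * \<phi> w + L w * pd d \<phi> w)
      + 2 * of_real (w \<bullet> d) * H1 ((cmod w)\<^sup>2) * (L w * \<phi> w)) 0"
    if "bounded_linear L" "d \<in> {1, \<i>}" "\<And>t. t < 1 \<Longrightarrow> (H has_vector_derivative H1 t) (at t)" "continuous_on {..<1} H1"
    for L d H H1
  proof (rule radial_integration_by_parts[OF that(3,4) dlin[OF that(1)] _ _ R(2)])
    have "continuous_on UNIV L" using that(1) by (simp add: linear_continuous_on)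
    then show "continuous_on UNIV (\<lambda>w. L w * \<phi> w)" "continuous_on UNIV (\<lambda>w. L d * \<phi> w + L w * pd d \<phi> w)"
      using that(2) by (intro continuous_intros cont(3)[of d d] cont(1)[of d d]; simp)+
  qed (auto simp: supp)
  note L = lin[OF bl(1) _ dB cB1, of 1] lin[OF bl(2) _ dB cB1, of \<i>] lin[OF bl(3) _ dC cC1, of 1] lin[OF bl(1) _ dC cC1, of \<i>]
  have sq: "(cmod w)\<^sup>2 = Re w * Re w + Im w * Im w" for w
    unfolding cmod_power2 by (simp only: power2_eq_square)
  have mixed: "has_bochner_integral lborel
    (\<lambda>w. A ((cmod w)\<^sup>2) * (pd 1 (pd \<i> \<phi>) w - pd \<i> (pd 1 \<phi>) w)) 0"
    by (rule radial_mixed_partials[OF dA dA1 cA2 \<phi>])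
  \<comment> \<open>The gradient of g(|w|^2) is 2 g1 w, hence the factor 2 before the terms with
    \<open>B\<close>. The products of the gradients of g and \<open>\<phi>\<close> cancel between
    \<open>A\<close> and \<open>B\<close>, leaving only the one with c'. The rotation field has
    components -y and x, so the terms with \<open>C1\<close> cancel.\<close>
  have "has_bochner_integral lborel (\<lambda>w.
     ((A ((cmod w)\<^sup>2) * pd 1 (pd 1 \<phi>) w + 2 * of_real (w \<bullet> 1) * A1 ((cmod w)\<^sup>2) * pd 1 \<phi> w)
    + (A ((cmod w)\<^sup>2) * pd \<i> (pd \<i> \<phi>) w + 2 * of_real (w \<bullet> \<i>) * A1 ((cmod w)\<^sup>2) * pd \<i> \<phi> w))
    + \<i> * (A ((cmod w)\<^sup>2) * (pd 1 (pd \<i> \<phi>) w - pd \<i> (pd 1 \<phi>) w))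
    + ((C ((cmod w)\<^sup>2) * (- complex_of_real (Im 1) * \<phi> w + - complex_of_real (Im w) * pd 1 \<phi> w)
      + 2 * of_real (w \<bullet> 1) * C1 ((cmod w)\<^sup>2) * (- complex_of_real (Im w) * \<phi> w))
    + (C ((cmod w)\<^sup>2) * (complex_of_real (Re \<i>) * \<phi> w + complex_of_real (Re w) * pd \<i> \<phi> w)
      + 2 * of_real (w \<bullet> \<i>) * C1 ((cmod w)\<^sup>2) * (complex_of_real (Re w) * \<phi> w)))
    - 2 * ((B ((cmod w)\<^sup>2) * (complex_of_real (Re 1) * \<phi> w + complex_of_real (Re w) * pd 1 \<phi> w)
      + 2 * of_real (w \<bullet> 1) * B1 ((cmod w)\<^sup>2) * (complex_of_real (Re w) * \<phi> w))
    + (B ((cmod w)\<^sup>2) * (complex_of_real (Im \<i>) * \<phi> w + complex_of_real (Im w) * pd \<i> \<phi> w)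
      + 2 * of_real (w \<bullet> \<i>) * B1 ((cmod w)\<^sup>2) * (complex_of_real (Im w) * \<phi> w)))) (((0 + 0) + \<i> * 0 + (0 + 0)) - 2 * (0 + 0))"
    by (intro has_bochner_integral_add has_bochner_integral_diff has_bochner_integral_mult_right 1 L mixed) auto
  then show ?thesis
    unfolding Let_def A_def A1_def B_def B1_def C_def C1_def sq
    by (rule has_bochner_integral_cong[THEN iffD1, rotated -1])
       (auto simp: inner_complex_def algebra_simps)
qed

lemma bounded_of_tendsto_at_right_0:
  fixes h :: "real \<Rightarrow> 'a::real_normed_vector"
  assumes "continuous_on {0<..<1} h" "(h \<longlongrightarrow> l) (at_right 0)" "r < 1"
  obtains B where "0 < B" "\<And>t. 0 < t \<Longrightarrow> t \<le> r \<Longrightarrow> norm (h t) \<le> B"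
proof -
  have "\<forall>\<^sub>F t in at_right 0. norm (h t) < norm l + 1"
    using tendsto_norm[OF assms(2)] by (rule order_tendstoD) simp
  then obtain b where b: "b > 0" "\<And>t. 0 < t \<Longrightarrow> t < b \<Longrightarrow> norm (h t) < norm l + 1"
    unfolding eventually_at_right_field by blast
  have "compact (h ` {b..r})"
    using b(1) assms(3) by (intro compact_continuous_image continuous_on_subset[OF assms(1)]) auto
  then have "bounded (h ` {b..r})" by (rule compact_imp_bounded)
  then obtain B where B: "B > 0" "\<And>t. t \<in> {b..r} \<Longrightarrow> norm (h t) \<le> B"
    unfolding bounded_pos by blast
  show thesis
  proof (rule that)
    show "0 < max B (norm l + 1)" using B(1) by simp
    show "norm (h t) \<le> max B (norm l + 1)" if "0 < t" "t \<le> r" for t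
      using b(2)[of t] B(2)[of t] that by (cases "t < b") auto
  qed
qed

text \<open>The hyperbolic density cancels the leading factor of the operator and leaves the
  Euclidean Laplacian. With w = x + iy, the first-order terms reduce to the rotation derivative
  through w \<open>dw\<close> - cnj w \<open>dwbar\<close> = -i (x d/dy - y d/dx). The commutator of
  the partial derivatives appears because \<open>dw (dwbar \<phi>)\<close> is an iterated
  derivative.\<close>

lemma hdens_Dop_expand:
  assumes \<phi>: "test_fun \<phi>" and w: "cmod w < 1"
  shows "hdens w *\<^sub>R (G * (- Dop (-k) \<phi> w - lam\<^sup>2 * \<phi> w)) = - (G *
    (pd 1 (pd 1 \<phi>) w + pd \<i> (pd \<i> \<phi>) w + \<i> * (pd 1 (pd \<i> \<phi>) w - pd \<i> (pd 1 \<phi>) w)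
     + 4 * \<i> * of_real k / of_real (1 - (cmod w)\<^sup>2) * (of_real (Re w) * pd \<i> \<phi> w - of_real (Im w) * pd 1 \<phi> w)
     + 4 * (of_real (k\<^sup>2 * (1 - (cmod w)\<^sup>2)) + (1 / 4 + lam\<^sup>2)) / of_real ((1 - (cmod w)\<^sup>2)\<^sup>2) * \<phi> w))"
proof -
  note der = test_fun_derivative(2)[OF \<phi>]
  have pdwbar: "pd d (dwbar \<phi>) w = (pd d (pd 1 \<phi>) w + \<i> * pd d (pd \<i> \<phi>) w) / 2" for d
  proof (rule pd_eqI)
    have "((\<lambda>t. pd 1 \<phi> (w + of_real t * d) + \<i> * pd \<i> \<phi> (w + of_real t * d)) has_vector_derivative
        pd d (pd 1 \<phi>) w + \<i> * pd d (pd \<i> \<phi>) w) (at 0)"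
      by (intro has_vector_derivative_add has_vector_derivative_mult_right der) auto
    from has_vector_derivative_mult_right[OF this, of "1 / 2"]
    show "((\<lambda>t. dwbar \<phi> (w + of_real t * d)) has_vector_derivative (pd d (pd 1 \<phi>) w + \<i> * pd d (pd \<i> \<phi>) w) / 2) (at 0)"
      by (simp add: dwbar_def)
  qed
  have lap: "dw (dwbar \<phi>) w = (pd 1 (pd 1 \<phi>) w + pd \<i> (pd \<i> \<phi>) w + \<i> * (pd 1 (pd \<i> \<phi>) w - pd \<i> (pd 1 \<phi>) w)) / 4"
    by (simp add: dw_def pdwbar algebra_simps add_divide_distrib diff_divide_distrib)
  have "w * dw \<phi> w - cnj w * dwbar \<phi> w = ((w - cnj w) * pd 1 \<phi> w - \<i> * (w + cnj w) * pd \<i> \<phi> w) / 2"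
    unfolding dw_def dwbar_def by (simp add: field_simps)
  also have "\<dots> = - \<i> * (of_real (Re w) * pd \<i> \<phi> w - of_real (Im w) * pd 1 \<phi> w)"
    unfolding complex_diff_cnj complex_add_cnj by (simp add: field_simps)
  finally have rot: "w * dw \<phi> w - cnj w * dwbar \<phi> w = - \<i> * (of_real (Re w) * pd \<i> \<phi> w - of_real (Im w) * pd 1 \<phi> w)" .
  define u where "u = complex_of_real (1 - (cmod w)\<^sup>2)"
  have u: "u \<noteq> 0" using w by (simp add: u_def abs_square_less_1 flip: of_real_power) 
       (metis abs_norm_cancel abs_square_less_1 less_irrefl of_real_1 of_real_eq_iff of_real_power)
  have t: "complex_of_real ((cmod w)\<^sup>2) = 1 - u" by (simp add: u_def)
  have dop: "Dop (-k) \<phi> w = u\<^sup>2 * dw (dwbar \<phi>) w - of_real k * u * (w * dw \<phi> w - cnj w * dwbar \<phi> w)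
      + ((of_real k)\<^sup>2 * u + 1 / 4) * \<phi> w"
    unfolding Dop_def of_real_add of_real_mult of_real_power[of "1 - (cmod w)\<^sup>2" 2] u_def[symmetric] t
    by (simp add: algebra_simps)
  have hd: "hdens w *\<^sub>R z = 4 / u\<^sup>2 * z" for z
    by (simp add: hdens_def scaleR_conv_of_real u_def)
  show ?thesis
    unfolding hd dop lap rot of_real_mult of_real_power u_def[symmetric]
    using u by (simp add: field_simps power2_eq_square)
qed

subsection \<open>The fundamental solution\<close>

theorem theorem1:
  fixes k :: real and lam s :: complex and \<phi> :: "complex \<Rightarrow> complex"
  assumes "s * (1 - s) = 1/4 + lam\<^sup>2"
    and "s - of_real \<bar>k\<bar> \<notin> \<int>\<^sub>\<le>\<^sub>0"
    and "s + of_real \<bar>k\<bar> \<notin> \<int>\<^sub>\<le>\<^sub>0"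
    and "2 * s \<notin> \<int>\<^sub>\<le>\<^sub>0"
    and "test_fun \<phi>"
  shows "set_integrable lborel (ball 0 1 - {0})
           (\<lambda>w. hdens w *\<^sub>R (Gk k s w * (- Dop (-k) \<phi> w - lam\<^sup>2 * \<phi> w)))
      \<and> (LINT w : ball 0 1 - {0} | lborel.
           hdens w *\<^sub>R (Gk k s w * (- Dop (-k) \<phi> w - lam\<^sup>2 * \<phi> w))) = \<phi> 0"
proof -
  note \<phi> = assms(5)
  obtain g g1 g2 where G: "\<And>w. w \<in> ball 0 1 \<Longrightarrow> Gk k s w = g ((cmod w)\<^sup>2)"
    "\<And>t. 0 < t \<Longrightarrow> t < 1 \<Longrightarrow> (g has_vector_derivative g1 t) (at t)"
    "\<And>t. 0 < t \<Longrightarrow> t < 1 \<Longrightarrow> (g1 has_vector_derivative g2 t) (at t)"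
    "continuous_on {0<..<1} g2"
    "\<And>t. 0 < t \<Longrightarrow> t < 1 \<Longrightarrow>
      g1 t + of_real t * g2 t = - (of_real (k\<^sup>2 * (1 - t)) + s * (1 - s)) / of_real ((1 - t)\<^sup>2) * g t"
    "((\<lambda>t. t *\<^sub>R g1 t) \<longlongrightarrow> - 1 / (4 * of_real pi)) (at_right 0)"
    using Gk_radial_profile[OF assms(2-4)] by blast
  obtain R where R: "0 < R" "R < 1" and supp: "\<And>w. R \<le> cmod w \<Longrightarrow> \<phi> w = 0"
      "\<And>d w. R \<le> cmod w \<Longrightarrow> pd d \<phi> w = 0" "\<And>d d' w. R \<le> cmod w \<Longrightarrow> pd d' (pd d \<phi>) w = 0"
    using test_fun_pd_support[OF \<phi>] by blast
  note cont = test_fun_continuous_on[OF \<phi>]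
  define D where "D = ball (0::complex) 1 - {0}"
  have D: "open D" "D \<in> sets borel" by (auto simp: D_def)
  have inD: "0 < (cmod w)\<^sup>2" "(cmod w)\<^sup>2 < 1" "cmod w < 1" if "w \<in> D" for w
    using that by (auto simp: D_def abs_square_less_1)
  \<comment> \<open>The profile times the coefficient of the rotation derivative in
    \<open>hdens_Dop_expand\<close>.\<close>
  define m where "m t = 4 * \<i> * of_real k / of_real (1 - t) * g t" for t
  define m1 where "m1 t = 4 * \<i> * of_real k / of_real (1 - t) * g1 t + 4 * \<i> * of_real k / (of_real (1 - t))\<^sup>2 * g t" for t
  have dm: "(m has_vector_derivative m1 t) (at t)" if t: "0 < t" "t < 1" for t
  proof -
    have "((\<lambda>t. 4 * \<i> * of_real k * complex_of_real (1 / (1 - t))) has_vector_derivative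
        4 * \<i> * of_real k * complex_of_real (1 / (1 - t)\<^sup>2)) (at t)"
      using t by (intro has_vector_derivative_mult_right has_vector_derivative_of_real)
        (auto intro!: derivative_eq_intros simp: power2_eq_square)
    from has_vector_derivative_mult[OF this G(2)[OF t]] show ?thesis
      by (simp add: m_def[abs_def] m1_def)
  qed
  have cg: "continuous_on {0<..<1} g" "continuous_on {0<..<1} g1"
    by (intro continuous_at_imp_continuous_on ballI has_vector_derivative_continuous[OF G(2)]
        has_vector_derivative_continuous[OF G(3)]; simp)+
  have cm1: "continuous_on {0<..<1} m1"
    unfolding m1_def by (intro continuous_intros cg) (auto simp: complex_eq_iff)
  have on_D: "continuous_on D (\<lambda>w. h ((cmod w)\<^sup>2))" if "continuous_on {0<..<1} h" for h :: "real \<Rightarrow> complex"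
    by (rule continuous_on_compose2[OF that]) (use inD in \<open>auto intro!: continuous_intros\<close>)
  define \<Psi> where "\<Psi> w = pd 1 (pd 1 \<phi>) w + pd \<i> (pd \<i> \<phi>) w + \<i> * (pd 1 (pd \<i> \<phi>) w - pd \<i> (pd 1 \<phi>) w)
     + 4 * \<i> * of_real k / of_real (1 - (cmod w)\<^sup>2) * (of_real (Re w) * pd \<i> \<phi> w - of_real (Im w) * pd 1 \<phi> w)
     + 4 * (of_real (k\<^sup>2 * (1 - (cmod w)\<^sup>2)) + (1 / 4 + lam\<^sup>2)) / of_real ((1 - (cmod w)\<^sup>2)\<^sup>2) * \<phi> w" for w
  have \<Psi>0: "\<Psi> w = 0" if "R \<le> cmod w" for w
    using supp[OF that] by (simp add: \<Psi>_def)
  have c\<Psi>: "continuous_on UNIV \<Psi>"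
  proof (rule continuous_on_UNIV_vanishing[OF _ R(2) \<Psi>0])
    have nz: "1 - (cmod w)\<^sup>2 \<noteq> 0" if "w \<in> ball 0 1" for w :: complex
      using that abs_square_less_1[of "cmod w"] by simp
    show "continuous_on (ball 0 1) \<Psi>"
      unfolding \<Psi>_def
      by (intro continuous_intros continuous_on_subset[OF cont(1)] continuous_on_subset[OF cont(2)] continuous_on_subset[OF cont(3)[of 1 1]])
        (use nz in \<open>auto simp del: of_real_diff of_real_power\<close>)
  qed
  obtain B\<Psi> where B\<Psi>: "B\<Psi> > 0" "\<And>w. norm (\<Psi> w) \<le> B\<Psi>"
    using bounded_continuous_cball_support[OF c\<Psi> \<Psi>0] by blast
  have sqg: "((\<lambda>t. sqrt t *\<^sub>R g t) \<longlongrightarrow> 0) (at_right 0)"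
    by (rule sqrt_scaled_tendsto_0[OF G(2,6)])
  have R2: "R\<^sup>2 < 1" using R by (simp add: abs_square_less_1)
  have csq: "continuous_on {0<..<1} (\<lambda>t. sqrt t *\<^sub>R g t)" "continuous_on {0<..<1} (\<lambda>t. t *\<^sub>R g1 t)"
    by (intro continuous_intros cg)+
  obtain Bg where Bg: "Bg > 0" "\<And>t. 0 < t \<Longrightarrow> t \<le> R\<^sup>2 \<Longrightarrow> norm (sqrt t *\<^sub>R g t) \<le> Bg"
    using bounded_of_tendsto_at_right_0[OF csq(1) sqg R2] by blast
  obtain Bh where Bh: "Bh > 0" "\<And>t. 0 < t \<Longrightarrow> t \<le> R\<^sup>2 \<Longrightarrow> norm (t *\<^sub>R g1 t) \<le> Bh"
    using bounded_of_tendsto_at_right_0[OF csq(2) G(6) R2] by blast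
  define I where "I w = indicator D w *\<^sub>R (- (g ((cmod w)\<^sup>2) * \<Psi> w))" for w
  have I_eq: "indicator D w *\<^sub>R (hdens w *\<^sub>R (Gk k s w * (- Dop (-k) \<phi> w - lam\<^sup>2 * \<phi> w))) = I w" for w
  proof (cases "w \<in> D")
    case True
    then show ?thesis
      using hdens_Dop_expand[OF \<phi> inD(3)[OF True], of "Gk k s w" k lam] G(1)[of w]
      by (simp add: I_def \<Psi>_def D_def)
  qed (simp add: I_def)
  have [measurable]: "I \<in> borel_measurable borel"
    unfolding I_def[abs_def]
    by (intro borel_measurable_continuous_on_indicator D continuous_intros on_D cg continuous_on_subset[OF c\<Psi>]) auto
  \<comment> \<open>The bound on sqrt t times g(t), read at t = |w|^2, gives |g| \<le>
    \<open>Bg\<close> / |w|. Beyond \<open>R\<close> the factor \<open>\<Psi>\<close>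
    vanishes.\<close>
  have I_bound: "norm (I w) \<le> Bg * B\<Psi> * (indicator (cball 0 1) w / cmod w)" for w
  proof (cases "w \<in> D \<and> cmod w < R")
    case True
    then have w: "0 < cmod w" "cmod w \<le> R" "cmod w \<le> 1" using R(2) by (auto simp: D_def)
    have "cmod w * norm (g ((cmod w)\<^sup>2)) \<le> Bg"
      using Bg(2)[of "(cmod w)\<^sup>2"] w by (simp add: power_mono)
    then have "norm (g ((cmod w)\<^sup>2)) \<le> Bg / cmod w" using w by (simp add: field_simps)
    then have "norm (g ((cmod w)\<^sup>2)) * norm (\<Psi> w) \<le> Bg / cmod w * B\<Psi>"
      using B\<Psi>(2) Bg(1) w by (intro mult_mono) auto
    then show ?thesis using True w by (simp add: I_def norm_mult)
  next
    case False
    then have "I w = 0" using \<Psi>0[of w] by (auto simp: I_def)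
    then show ?thesis using Bg(1) B\<Psi>(1) by simp
  qed
  have int_bound: "integrable lborel (\<lambda>w. Bg * B\<Psi> * (indicator (cball 0 1) w / cmod w))"
    using integrable_inverse_norm by (intro integrable_mult_right)
  have intI: "integrable lborel I"
  proof (rule Bochner_Integration.integrable_bound[OF int_bound])
    show "AE w in lborel. norm (I w) \<le> norm (Bg * B\<Psi> * (indicator (cball 0 1) w / cmod w))"
      unfolding real_norm_def by (intro AE_I2 order_trans[OF I_bound abs_ge_self])
  qed simp
  \<comment> \<open>This is the function that multiplies the derivative of the cutoff in
    \<open>cut_green_identity\<close>. At the origin its gradient part tends to 0 since |w| g does,
    and the rest tends to -4 (-1/(4 pi)) \<open>\<phi> 0\<close>.\<close>
  define q where "q w = indicator D w *\<^sub>R (2 * g ((cmod w)\<^sup>2) * (of_real (Re w) * pd 1 \<phi> w + of_real (Im w) * pd \<i> \<phi> w)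
     - 4 * of_real ((cmod w)\<^sup>2) * g1 ((cmod w)\<^sup>2) * \<phi> w)" for w
  have [measurable]: "q \<in> borel_measurable borel"
    unfolding q_def[abs_def]
    by (intro borel_measurable_continuous_on_indicator D continuous_intros on_D cg
        continuous_on_subset[OF cont(1)] continuous_on_subset[OF cont(3)[of 1 1]]) auto
  have q_split: "norm (2 * g ((cmod w)\<^sup>2) * (of_real (Re w) * pd 1 \<phi> w + of_real (Im w) * pd \<i> \<phi> w))
      \<le> 2 * norm (sqrt ((cmod w)\<^sup>2) *\<^sub>R g ((cmod w)\<^sup>2)) * (norm (pd 1 \<phi> w) + norm (pd \<i> \<phi> w))" for w
  proof -
    have "norm (of_real (Re w) * pd 1 \<phi> w + of_real (Im w) * pd \<i> \<phi> w)
        \<le> \<bar>Re w\<bar> * norm (pd 1 \<phi> w) + \<bar>Im w\<bar> * norm (pd \<i> \<phi> w)"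
      by (rule order_trans[OF norm_triangle_ineq]) (simp add: norm_mult)
    also have "\<dots> \<le> cmod w * norm (pd 1 \<phi> w) + cmod w * norm (pd \<i> \<phi> w)"
      by (intro add_mono mult_right_mono abs_Re_le_cmod abs_Im_le_cmod) auto
    finally have "norm (g ((cmod w)\<^sup>2)) * norm (of_real (Re w) * pd 1 \<phi> w + of_real (Im w) * pd \<i> \<phi> w)
      \<le> norm (g ((cmod w)\<^sup>2)) * (cmod w * norm (pd 1 \<phi> w) + cmod w * norm (pd \<i> \<phi> w))"
      by (rule mult_left_mono) simp
    moreover have "2 * norm (sqrt ((cmod w)\<^sup>2) *\<^sub>R g ((cmod w)\<^sup>2)) * (a + b)
        = 2 * (norm (g ((cmod w)\<^sup>2)) * (cmod w * a + cmod w * b))" for a b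
      by (simp add: algebra_simps)
    moreover have "norm (2 * g ((cmod w)\<^sup>2) * z) = 2 * (norm (g ((cmod w)\<^sup>2)) * norm z)" for z
      by (simp add: norm_mult)
    ultimately show ?thesis by (simp only: mult_left_mono zero_le_numeral)
  qed
  obtain B1 where B1: "B1 > 0" "\<And>w. norm (pd 1 \<phi> w) \<le> B1"
    using bounded_continuous_cball_support[OF cont(1)[of 1 1] supp(2)] by auto
  obtain B2 where B2: "B2 > 0" "\<And>w. norm (pd \<i> \<phi> w) \<le> B2"
    using bounded_continuous_cball_support[OF cont(1)[of \<i> 1] supp(2)] by auto
  obtain B0 where B0: "B0 > 0" "\<And>w. norm (\<phi> w) \<le> B0"
    using bounded_continuous_cball_support[OF cont(3)[of 1 1] supp(1)] by auto
  have q_bound: "norm (q w) \<le> 2 * Bg * (B1 + B2) + 4 * Bh * B0" for w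
  proof (cases "w \<in> D \<and> cmod w < R")
    case True
    then have w: "0 < (cmod w)\<^sup>2" "(cmod w)\<^sup>2 \<le> R\<^sup>2" by (auto simp: D_def power_mono)
    have "norm (2 * g ((cmod w)\<^sup>2) * (of_real (Re w) * pd 1 \<phi> w + of_real (Im w) * pd \<i> \<phi> w)) \<le> 2 * Bg * (B1 + B2)"
      by (rule order_trans[OF q_split], intro mult_mono add_mono B1 B2 Bg(2) w)
        (use Bg(1) in \<open>auto simp del: norm_scaleR intro: add_nonneg_nonneg\<close>)
    moreover have "norm (4 * of_real ((cmod w)\<^sup>2) * g1 ((cmod w)\<^sup>2) * \<phi> w) \<le> 4 * Bh * B0"
    proof -
      have "norm (4 * of_real ((cmod w)\<^sup>2) * g1 ((cmod w)\<^sup>2) * \<phi> w) = 4 * norm ((cmod w)\<^sup>2 *\<^sub>R g1 ((cmod w)\<^sup>2)) * norm (\<phi> w)"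
        by (simp add: norm_mult norm_power)
      also have "\<dots> \<le> 4 * Bh * B0"
        by (intro mult_mono Bh(2) B0(2) w) (use Bh(1) in auto)
      finally show ?thesis .
    qed
    ultimately show ?thesis
      using True unfolding q_def by (simp del: norm_mult) (rule order_trans[OF norm_triangle_ineq4], simp)
  next
    case False
    then have "q w = 0" using supp[of w] by (auto simp: q_def)
    then show ?thesis using Bg(1) Bh(1) B0(1) B1(1) B2(1) by simp
  qed
  have sq_lim: "filterlim (\<lambda>w. (cmod w)\<^sup>2) (at_right 0) (at (0::complex))"
  proof -
    have "((\<lambda>w::complex. (cmod w)\<^sup>2) \<longlongrightarrow> (cmod 0)\<^sup>2) (at 0)" by (intro tendsto_intros)
    moreover have "\<forall>\<^sub>F w in at (0::complex). (cmod w)\<^sup>2 \<in> {0<..} \<and> (cmod w)\<^sup>2 \<noteq> 0"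
      by (auto simp: eventually_at_filter)
    ultimately show ?thesis by (auto simp: filterlim_at)
  qed
  have at0: "(f \<longlongrightarrow> f 0) (at 0)" if "continuous_on UNIV f" for f :: "complex \<Rightarrow> complex"
    using that by (simp add: continuous_on_def)
  have q_lim: "(q \<longlongrightarrow> \<phi> 0 / of_real pi) (at 0)"
  proof -
    have l1: "((\<lambda>w. 2 * norm (sqrt ((cmod w)\<^sup>2) *\<^sub>R g ((cmod w)\<^sup>2)) * (norm (pd 1 \<phi> w) + norm (pd \<i> \<phi> w)))
        \<longlongrightarrow> 2 * norm (0::complex) * (norm (pd 1 \<phi> 0) + norm (pd \<i> \<phi> 0))) (at 0)"
      by (intro tendsto_intros filterlim_compose[OF sqg sq_lim] at0 cont(1)[of _ 1]) auto
    have "((\<lambda>w. 2 * g ((cmod w)\<^sup>2) * (of_real (Re w) * pd 1 \<phi> w + of_real (Im w) * pd \<i> \<phi> w)) \<longlongrightarrow> 0) (at 0)"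
      by (rule Lim_null_comparison[OF always_eventually[OF allI[OF q_split]]]) (use l1 in simp)
    moreover have "((\<lambda>w. 4 * ((cmod w)\<^sup>2 *\<^sub>R g1 ((cmod w)\<^sup>2)) * \<phi> w) \<longlongrightarrow> 4 * (- 1 / (4 * of_real pi)) * \<phi> 0) (at 0)"
      by (intro tendsto_intros filterlim_compose[OF G(6) sq_lim] at0 cont(3)[of 1 1]) auto
    ultimately have "((\<lambda>w. 2 * g ((cmod w)\<^sup>2) * (of_real (Re w) * pd 1 \<phi> w + of_real (Im w) * pd \<i> \<phi> w)
       - 4 * ((cmod w)\<^sup>2 *\<^sub>R g1 ((cmod w)\<^sup>2)) * \<phi> w) \<longlongrightarrow> 0 - 4 * (- 1 / (4 * of_real pi)) * \<phi> 0) (at 0)"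
      by (rule tendsto_diff)
    then have l2: "((\<lambda>w. 2 * g ((cmod w)\<^sup>2) * (of_real (Re w) * pd 1 \<phi> w + of_real (Im w) * pd \<i> \<phi> w)
       - 4 * ((cmod w)\<^sup>2 *\<^sub>R g1 ((cmod w)\<^sup>2)) * \<phi> w) \<longlongrightarrow> \<phi> 0 / of_real pi) (at 0)"
      by simp
    have "\<forall>\<^sub>F w in at (0::complex). w \<in> D"
      by (auto simp: D_def eventually_at dist_norm intro!: exI[of _ 1])
    then have "\<forall>\<^sub>F w in at 0. 2 * g ((cmod w)\<^sup>2) * (of_real (Re w) * pd 1 \<phi> w + of_real (Im w) * pd \<i> \<phi> w)
       - 4 * ((cmod w)\<^sup>2 *\<^sub>R g1 ((cmod w)\<^sup>2)) * \<phi> w = q w"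
      by eventually_elim (simp add: q_def scaleR_conv_of_real)
    with l2 show ?thesis by (rule Lim_transform_eventually)
  qed
  define \<delta> where "\<delta> n = 1 / real (Suc n)" for n
  have \<delta>: "\<delta> n > 0" "\<delta> \<longlonglongrightarrow> 0" for n
    unfolding \<delta>_def by (simp, rule LIMSEQ_Suc[OF lim_1_over_n])
  have [measurable]: "cutoff \<in> borel_measurable borel" "cutoff' \<in> borel_measurable borel"
    unfolding cutoff_def[abs_def] cutoff'_def[abs_def] by measurable
  have cutoff_mult_le: "AE w in lborel. norm (of_real (cutoff (f w)) * I w) \<le> norm (I w)" for f
    by (intro AE_I2) (simp add: norm_mult cutoff_bounds mult_left_le_one_le)
  have green: "(\<integral>w. of_real (cutoff ((cmod w)\<^sup>2 / d\<^sup>2)) * I w \<partial>lborel)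
      = (\<integral>w. of_real (cutoff' ((cmod w)\<^sup>2 / d\<^sup>2) / d\<^sup>2) * q w \<partial>lborel)" if d: "d > 0" for d
  proof -
    have "has_bochner_integral lborel (\<lambda>w. let t = (cmod w)\<^sup>2; x = of_real (Re w); y = of_real (Im w) in
      of_real (cutoff (t / d\<^sup>2)) * (g t * (pd 1 (pd 1 \<phi>) w + pd \<i> (pd \<i> \<phi>) w + \<i> * (pd 1 (pd \<i> \<phi>) w - pd \<i> (pd 1 \<phi>) w))
         + m t * (x * pd \<i> \<phi> w - y * pd 1 \<phi> w) - 4 * (g1 t + of_real t * g2 t) * \<phi> w)
      + of_real (cutoff' (t / d\<^sup>2) / d\<^sup>2) * (2 * g t * (x * pd 1 \<phi> w + y * pd \<i> \<phi> w) - 4 * of_real t * g1 t * \<phi> w)) 0"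
    proof (rule cut_green_identity[where e="d\<^sup>2" and c''="\<lambda>t. cutoff'' (t / d\<^sup>2) / d\<^sup>2 / d\<^sup>2", OF _ _ _ _ _ _ _ G(2-4) dm cm1 \<phi>])
      have ch: "((\<lambda>t. f (t / d\<^sup>2)) has_real_derivative f' / d\<^sup>2) (at t)" if "(f has_real_derivative f') (at (t / d\<^sup>2))" for f f' and t :: real
      proof -
        have "((\<lambda>t. t / d\<^sup>2) has_real_derivative 1 / d\<^sup>2) (at t)"
          by (rule DERIV_cdivide[OF DERIV_ident])
        from DERIV_chain2[where f=f and g="\<lambda>t. t / d\<^sup>2" and x=t, OF that this] show ?thesis by simp
      qed
      show "((\<lambda>t. cutoff (t / d\<^sup>2)) has_real_derivative cutoff' (t / d\<^sup>2) / d\<^sup>2) (at t)" for t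
        by (rule ch[OF has_real_derivative_cutoff])
      show "((\<lambda>t. cutoff' (t / d\<^sup>2) / d\<^sup>2) has_real_derivative cutoff'' (t / d\<^sup>2) / d\<^sup>2 / d\<^sup>2) (at t)" for t
        by (rule DERIV_cdivide[OF ch[OF has_real_derivative_cutoff']])
      show "continuous_on UNIV (\<lambda>t. cutoff'' (t / d\<^sup>2) / d\<^sup>2 / d\<^sup>2)"
        using d by (intro continuous_intros continuous_on_compose2[OF continuous_on_cutoff'']) auto
    qed (use d in \<open>auto simp: cutoff_def cutoff'_def cutoff''_def divide_le_eq\<close>)
    then have "has_bochner_integral lborel (\<lambda>w. of_real (cutoff' ((cmod w)\<^sup>2 / d\<^sup>2) / d\<^sup>2) * q w - of_real (cutoff ((cmod w)\<^sup>2 / d\<^sup>2)) * I w) 0"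
    proof (rule has_bochner_integral_cong[THEN iffD1, rotated -1, OF _ refl _ refl])
      fix w :: complex
      show "(let t = (cmod w)\<^sup>2; x = of_real (Re w); y = of_real (Im w) in
      of_real (cutoff (t / d\<^sup>2)) * (g t * (pd 1 (pd 1 \<phi>) w + pd \<i> (pd \<i> \<phi>) w + \<i> * (pd 1 (pd \<i> \<phi>) w - pd \<i> (pd 1 \<phi>) w))
         + m t * (x * pd \<i> \<phi> w - y * pd 1 \<phi> w) - 4 * (g1 t + of_real t * g2 t) * \<phi> w)
      + of_real (cutoff' (t / d\<^sup>2) / d\<^sup>2) * (2 * g t * (x * pd 1 \<phi> w + y * pd \<i> \<phi> w) - 4 * of_real t * g1 t * \<phi> w))
      = of_real (cutoff' ((cmod w)\<^sup>2 / d\<^sup>2) / d\<^sup>2) * q w - of_real (cutoff ((cmod w)\<^sup>2 / d\<^sup>2)) * I w"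
      proof (cases "w \<in> D")
        case True
        \<comment> \<open>The radial equation, with s (1 - s) = 1/4 + lam^2, turns -4 (g1 + t g2)
          into g times the zeroth-order coefficient 4 \<open>N\<close> / \<open>v\<close> of
          \<open>\<Psi>\<close>, so the factor of the cutoff becomes g \<open>\<Psi>\<close>. Naming
          \<open>N\<close> and \<open>v\<close> leaves an identity of polynomials.\<close>
        define N where "N = complex_of_real (k\<^sup>2 * (1 - (cmod w)\<^sup>2)) + (1 / 4 + lam\<^sup>2)"
        define v where "v = complex_of_real ((1 - (cmod w)\<^sup>2)\<^sup>2)"
        show ?thesis
          using True unfolding Let_def G(5)[OF inD(1,2)[OF True]] assms(1) q_def I_def \<Psi>_def m_def
            N_def[symmetric] v_def[symmetric]
          by (simp add: algebra_simps)
      next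
        case False
        then consider "w = 0" | "1 \<le> cmod w" by (auto simp: D_def)
        then show ?thesis
        proof cases
          case 2
          then have "R \<le> cmod w" using R(2) by simp
          then show ?thesis using False by (simp add: supp Let_def q_def I_def)
        qed (simp add: cutoff_def cutoff'_def Let_def q_def I_def D_def)
      qed
    qed
    note sum = this
    \<comment> \<open>The Green identity provides the integral of the difference only; splitting it
      requires the integrability of one summand.\<close>
    have intc: "integrable lborel (\<lambda>w. of_real (cutoff ((cmod w)\<^sup>2 / d\<^sup>2)) * I w)"
      by (rule Bochner_Integration.integrable_bound[OF intI _ cutoff_mult_le]) measurable
    have "has_bochner_integral lborel (\<lambda>w. of_real (cutoff' ((cmod w)\<^sup>2 / d\<^sup>2) / d\<^sup>2) * q w)
      (0 + (\<integral>w. of_real (cutoff ((cmod w)\<^sup>2 / d\<^sup>2)) * I w \<partial>lborel))"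
      using has_bochner_integral_add[OF sum has_bochner_integral_integrable[OF intc]] by simp
    then show ?thesis by (simp add: has_bochner_integral_iff)
  qed
  \<comment> \<open>Two limits of the same sequence: on this side the cutoff increases to 1 off the
    origin, while the other side of \<open>green\<close> concentrates at the origin.\<close>
  have "(\<lambda>n. \<integral>w. of_real (cutoff ((cmod w)\<^sup>2 / (\<delta> n)\<^sup>2)) * I w \<partial>lborel) \<longlonglongrightarrow> (\<integral>w. I w \<partial>lborel)"
  proof (rule integral_dominated_convergence)
    show "integrable lborel (\<lambda>w. norm (I w))" using intI by simp
    show "AE w in lborel. norm (of_real (cutoff ((cmod w)\<^sup>2 / (\<delta> n)\<^sup>2)) * I w) \<le> norm (I w)" for n
      by (rule cutoff_mult_le)
    show "AE w in lborel. (\<lambda>n. of_real (cutoff ((cmod w)\<^sup>2 / (\<delta> n)\<^sup>2)) * I w) \<longlonglongrightarrow> I w"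
    proof (rule AE_I2)
      fix w :: complex
      show "(\<lambda>n. of_real (cutoff ((cmod w)\<^sup>2 / (\<delta> n)\<^sup>2)) * I w) \<longlonglongrightarrow> I w"
      proof (cases "w = 0")
        case False
        then have a: "(cmod w)\<^sup>2 > 0" by simp
        define a where "a = (cmod w)\<^sup>2"
        have "(\<lambda>n. cutoff (a / (\<delta> n)\<^sup>2)) \<longlonglongrightarrow> 1"
        proof (rule Lim_transform_eventually)
          show "(\<lambda>n. (1 - 1 / (a / (\<delta> n)\<^sup>2)) ^ 3) \<longlonglongrightarrow> 1"
            using a unfolding a_def[symmetric] \<delta>_def by real_asymp
          have "\<forall>\<^sub>F n in sequentially. a / (\<delta> n)\<^sup>2 > 1"
            using a unfolding a_def[symmetric] \<delta>_def by real_asymp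
          then show "\<forall>\<^sub>F n in sequentially. (1 - 1 / (a / (\<delta> n)\<^sup>2)) ^ 3 = cutoff (a / (\<delta> n)\<^sup>2)"
            by eventually_elim (simp add: cutoff_def)
        qed
        from tendsto_mult[OF tendsto_of_real[OF this] tendsto_const[of "I w"]]
        show ?thesis by (simp add: a_def)
      qed (simp add: I_def D_def)
    qed
  qed auto
  moreover have "(\<lambda>n. \<integral>w. of_real (cutoff ((cmod w)\<^sup>2 / (\<delta> n)\<^sup>2)) * I w \<partial>lborel) \<longlonglongrightarrow> \<phi> 0"
  proof -
    have "(\<lambda>n. \<integral>w. of_real (cutoff' ((cmod w)\<^sup>2 / (\<delta> n)\<^sup>2) / (\<delta> n)\<^sup>2) * q w \<partial>lborel) \<longlonglongrightarrow> pi * (\<phi> 0 / of_real pi)"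
      by (rule tendsto_integral_cutoff'[OF _ q_bound q_lim \<delta>]) measurable
    then show ?thesis unfolding green[OF \<delta>(1)] by simp
  qed
  ultimately have "(\<integral>w. I w \<partial>lborel) = \<phi> 0" by (rule LIMSEQ_unique)
  with intI show ?thesis
    unfolding set_integrable_def set_lebesgue_integral_def D_def[symmetric] I_eq by blast
qed

end
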